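(* Let $(Z_t(x))_{x\in\mathbb{Z},\,0\le t\le T}$ be a coalescing skip-free process on $\mathbb{Z}$ with every site initially occupied, let $P(x,y)$ be its one-particle transition probability from $x$ at time $0$ to $y$ at the fixed time $T>0$, and let $F(x,y)=\sum_{z\le y}P(x,z)$. Let $k\ge 1$, let $x_{1/2}<x_{3/2}<\cdots<x_{k-1/2}$ be elements of $\mathbb{Z}+\tfrac12$, and let $y_0<y_1<\cdots<y_k$ be integers. Then the probability that the wall-particle system $(\mathbf{X},\mathbf{Y})$ at time $T$ contains the consecutive pattern $$y_0 \nwarrow x_{1/2}\nearrow y_1\nwarrow x_{3/2}\nearrow\cdots\nwarrow x_{k-1/2}\nearrow y_k$$ equals $\det(\tilde M)$, where $\tilde M$ is the following $2k\times 2k$ matrix. For $l=1,\dots,k$ put $a_l=x_{l-1/2}-\tfrac12$ and $b_l=x_{l-1/2}+\tfrac12$, and let $s_{2l-1}=a_l$, $s_{2l}=b_l$. For $1\le i\le 2k$, $$\tilde M_{i,1}=P(s_i,y_0),\qquad \tilde M_{i,2k}=P(s_i,y_k),$$ and for $1\le l\le k-1$, $$\tilde M_{i,2l}=P(s_i,y_l),\qquad \tilde M_{i,2l+1}=F(s_i,y_l)-[\,i<2l+1\,],$$ where $[\cdot]$ is the Iverson bracket ($1$ if the condition holds, $0$ otherwise).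
   Context: Skip-free process on $\mathbb{Z}$: a Markov process on $\mathbb{Z}$ satisfying the Karlin–McGregor assumptions, i.e. its transitions are only to neighbouring states, so that two independent copies started from distinct occupied sites cannot change their order without first being at the same site at the same time. No symmetry and no spatial or temporal homogeneity is assumed. Coalescing system with every site occupied: one particle starts at each $x\in\mathbb{Z}$ and $Z_t(x)$ is the position at time $t$ of the particle started at $x$. Distinct particles move independently as copies of the skip-free process until they meet; when particles meet they merge and continue as one. (The infinite system is consistent: for every finite set $A$ of starting sites, $(Z_t(x))_{x\in A}$ has the law of the coalescing system started from $A$ alone.) Wall-particle system: fix $T>0$. The survivors are the distinct positions occupied at time $T$; $\mathbf{Y}$ is their increasing sequence. The basin of a survivor at $y$ is the set $\{x\in\mathbb{Z}: Z_T(x)=y\}$, a contiguous set of integers; the basins partition $\mathbb{Z}$. A wall is a half-integer $x\in\mathbb{Z}+\frac12$ such that $x-\frac12$ and $x+\frac12$ belong to different basins; $\mathbf{X}$ is the increasing sequence of walls. Walls are time-$0$ coordinates, survivors are time-$T$ coordinates. "$(\mathbf{X},\mathbf{Y})$ contains the consecutive pattern $y_0 \nwarrow x_{1/2}\nearrow y_1\nwarrow\cdots\nwarrow x_{k-1/2}\nearrow y_k$" means: $x_{1/2},\dots,x_{k-1/2}$ are consecutive walls (all are walls and there are no other walls between them), $y_0$ is the survivor whose basin lies immediately to the left of $x_{1/2}$, $y_l$ (for $1\le l\le k-1$) is the survivor whose basin is the set of integers in $(x_{l-1/2},x_{l+1/2})$, and $y_k$ is the survivor whose basin lies immediately to the right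 of $x_{k-1/2}$. *)

theory Defs
  imports "HOL-Probability.Probability" "Jordan_Normal_Form.Determinant"
begin

section \<open>Skip-free processes\<close>

text \<open>
  Time runs through the real interval \<open>[0, T]\<close>. A path is a right-continuous step function
  with left limits in \<open>\<int>\<close> (discrete topology) whose jumps lead to neighbouring states only.
  A process in discrete time is included as a path that is constant between integer times.
\<close>

definition skip_free_paths :: "real \<Rightarrow> (real \<Rightarrow> int) set" where
  "skip_free_paths T =
     {w. (\<forall>t\<in>{0..<T}. \<forall>\<^sub>F u in at_right t. w u = w t) \<and>
         (\<forall>t\<in>{0<..T}. \<exists>z. (\<forall>\<^sub>F u in at_left t. w u = z) \<and> \<bar>w t - z\<bar> \<le> 1)}"

definition path_space :: "real \<Rightarrow> (real \<Rightarrow> int) measure" where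
  "path_space T =
     restrict_space (\<Pi>\<^sub>M t\<in>{0..T}. count_space UNIV) (skip_free_paths T)"

definition trans_prob ::
    "(real \<Rightarrow> int \<Rightarrow> (real \<Rightarrow> int) measure) \<Rightarrow> real \<Rightarrow> real \<Rightarrow> int \<Rightarrow> int \<Rightarrow> real" where
  "trans_prob Pr s t x y = measure (Pr s x) {w \<in> space (Pr s x). w t = y}"

text \<open>
  A (time-inhomogeneous) Markov process is given by the laws \<open>Pr s x\<close> of its path when it is
  started from \<open>x\<close> at time \<open>s\<close>; under \<open>Pr s x\<close> the path before time \<open>s\<close> carries no information.
  The last condition is the Karlin--McGregor assumption. It has to be required in addition to
  jumps of size one, because without temporal homogeneity two independent copies may jump at the
  same deterministic time and thereby exchange neighbouring sites.
\<close>

definition skip_free_process :: "real \<Rightarrow> (real \<Rightarrow> int \<Rightarrow> (real \<Rightarrow> int) measure) \<Rightarrow> bool" where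
  "skip_free_process T Pr \<longleftrightarrow>
     (\<forall>s\<in>{0..T}. \<forall>x.
        prob_space (Pr s x) \<and> sets (Pr s x) = sets (path_space T) \<and>
        (AE w in Pr s x. w s = x)) \<and>
     (\<forall>s t u x y z I c.
        0 \<le> s \<and> s \<le> t \<and> t \<le> u \<and> u \<le> T \<and> finite I \<and> I \<subseteq> {s..t} \<longrightarrow>
        measure (Pr s x) {w \<in> space (Pr s x). (\<forall>r\<in>I. w r = c r) \<and> w t = y \<and> w u = z} =
        measure (Pr s x) {w \<in> space (Pr s x). (\<forall>r\<in>I. w r = c r) \<and> w t = y} *
          trans_prob Pr t u y z) \<and>
     (\<forall>x y. x < y \<longrightarrow>
        (AE (w, w') in Pr 0 x \<Otimes>\<^sub>M Pr 0 y.
           \<forall>t\<in>{0..T}. (\<forall>u\<in>{0..t}. w u \<noteq> w' u) \<longrightarrow> w t < w' t))"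


section \<open>Coalescing systems\<close>

text \<open>
  \<open>merge_path C w\<close> follows \<open>w\<close> until \<open>w\<close> first meets one of the paths in \<open>C\<close>, and follows the path
  it has met from then on. The paths in \<open>C\<close> are themselves already coalesced, so that the
  description determines a unique position even if several of them are met at once.
\<close>

definition merge_path :: "(real \<Rightarrow> int) set \<Rightarrow> (real \<Rightarrow> int) \<Rightarrow> real \<Rightarrow> int" where
  "merge_path C w t =
     (if \<exists>u\<in>{0..t}. \<exists>g\<in>C. g u = w u
      then THE z. \<exists>g\<in>C. z = g t \<and>
             (\<exists>u\<in>{0..t}. g u = w u \<and> (\<forall>v\<in>{0..<u}. \<forall>h\<in>C. h v \<noteq> w v))
      else w t)"

primrec coalesce_list :: "int list \<Rightarrow> (int \<Rightarrow> real \<Rightarrow> int) \<Rightarrow> int \<Rightarrow> real \<Rightarrow> int" where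
  "coalesce_list [] w = w"
| "coalesce_list (x # xs) w =
     (coalesce_list xs w)(x := merge_path (coalesce_list xs w ` set xs) (w x))"

text \<open>
  The coalescing system started from a finite set \<open>A\<close>, as a function of the driving paths
  \<open>w x\<close>, \<open>x \<in> A\<close>: a merged particle is driven by the path of its rightmost starting site.
  By the strong Markov property this choice does not influence the law when the driving paths
  are independent copies of a skip-free process.
\<close>

definition coalesce :: "int set \<Rightarrow> (int \<Rightarrow> real \<Rightarrow> int) \<Rightarrow> int \<Rightarrow> real \<Rightarrow> int" where
  "coalesce A w = coalesce_list (sorted_list_of_set A) w"

text \<open>
  \<open>Z t x\<close> is the position at time \<open>t\<close> of the particle started at \<open>x\<close>, where one particle starts at
  every site of \<open>\<int>\<close>. The law of the infinite system is determined by those of its finite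
  subsystems.
\<close>

definition coalescing_system ::
    "real \<Rightarrow> (real \<Rightarrow> int \<Rightarrow> (real \<Rightarrow> int) measure) \<Rightarrow> 'a measure \<Rightarrow>
     (real \<Rightarrow> int \<Rightarrow> 'a \<Rightarrow> int) \<Rightarrow> bool" where
  "coalescing_system T Pr M Z \<longleftrightarrow>
     prob_space M \<and>
     (\<forall>t\<in>{0..T}. \<forall>x. Z t x \<in> measurable M (count_space UNIV)) \<and>
     (\<forall>A. finite A \<longrightarrow>
        distr M (\<Pi>\<^sub>M i\<in>{0..T} \<times> A. count_space UNIV)
          (\<lambda>\<omega>. \<lambda>(t, x)\<in>{0..T} \<times> A. Z t x \<omega>) =
        distr (\<Pi>\<^sub>M x\<in>A. Pr 0 x) (\<Pi>\<^sub>M i\<in>{0..T} \<times> A. count_space UNIV)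
          (\<lambda>w. \<lambda>(t, x)\<in>{0..T} \<times> A. coalesce A w x t))"


section \<open>The wall-particle system\<close>

text \<open>Here \<open>f x\<close> is the time-\<open>T\<close> position of the particle started at \<open>x\<close>.\<close>

definition survivors :: "(int \<Rightarrow> int) \<Rightarrow> int set" where
  "survivors f = range f"

definition basin :: "(int \<Rightarrow> int) \<Rightarrow> int \<Rightarrow> int set" where
  "basin f y = {x. f x = y}"

definition half_integers :: "real set" where
  "half_integers = {of_int n + 1/2 | n. True}"

text \<open>The sites \<open>x - 1/2\<close> and \<open>x + 1/2\<close> adjacent to a half-integer \<open>x\<close>.\<close>

definition left_site :: "real \<Rightarrow> int" where
  "left_site x = \<lfloor>x - 1/2\<rfloor>"

definition right_site :: "real \<Rightarrow> int" where
  "right_site x = \<lfloor>x + 1/2\<rfloor>"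

definition walls :: "(int \<Rightarrow> int) \<Rightarrow> real set" where
  "walls f = {x \<in> half_integers. basin f (f (left_site x)) \<noteq> basin f (f (right_site x))}"

text \<open>
  \<open>x l\<close> stands for the half-integer \<open>x\<^bsub>l-1/2\<^esub>\<close>, \<open>1 \<le> l \<le> k\<close>.
\<close>

definition contains_pattern :: "(int \<Rightarrow> int) \<Rightarrow> nat \<Rightarrow> (nat \<Rightarrow> real) \<Rightarrow> (nat \<Rightarrow> int) \<Rightarrow> bool" where
  "contains_pattern f k x y \<longleftrightarrow>
     (\<forall>l\<in>{1..k}. x l \<in> walls f) \<and>
     walls f \<inter> {x 1..x k} \<subseteq> x ` {1..k} \<and>
     (\<forall>l\<in>{0..k}. y l \<in> survivors f) \<and>
     (left_site (x 1) \<in> basin f (y 0) \<and> (\<forall>n\<in>basin f (y 0). of_int n < x 1)) \<and>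
     (\<forall>l\<in>{1..<k}. basin f (y l) = {n. x l < of_int n \<and> of_int n < x (l + 1)}) \<and>
     (right_site (x k) \<in> basin f (y k) \<and> (\<forall>n\<in>basin f (y k). x k < of_int n))"


section \<open>The matrix\<close>

definition cdf_at :: "(int \<Rightarrow> int \<Rightarrow> real) \<Rightarrow> int \<Rightarrow> int \<Rightarrow> real" where
  "cdf_at P x y = (\<Sum>\<^sub>\<infinity>z\<in>{..y}. P x z)"

definition start_site :: "(nat \<Rightarrow> real) \<Rightarrow> nat \<Rightarrow> int" where
  "start_site x i =
     (if odd i then left_site (x ((i + 1) div 2)) else right_site (x (i div 2)))"

text \<open>
  Rows and columns of \<open>pattern_entry\<close> are numbered from 1, those of matrices from 0.
\<close>

definition pattern_entry ::
    "(int \<Rightarrow> int \<Rightarrow> real) \<Rightarrow> nat \<Rightarrow> (nat \<Rightarrow> real) \<Rightarrow> (nat \<Rightarrow> int) \<Rightarrow> nat \<Rightarrow> nat \<Rightarrow> real" where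
  "pattern_entry P k x y i j =
     (if j = 1 then P (start_site x i) (y 0)
      else if j = 2 * k then P (start_site x i) (y k)
      else if even j then P (start_site x i) (y (j div 2))
      else cdf_at P (start_site x i) (y (j div 2)) - of_bool (i < j))"

definition pattern_matrix ::
    "(int \<Rightarrow> int \<Rightarrow> real) \<Rightarrow> nat \<Rightarrow> (nat \<Rightarrow> real) \<Rightarrow> (nat \<Rightarrow> int) \<Rightarrow> real mat" where
  "pattern_matrix P k x y =
     Matrix.mat (2 * k) (2 * k) (\<lambda>(i, j). pattern_entry P k x y (i + 1) (j + 1))"

end

theory Submission
  imports Defs
begin

text \<open>
  Almost surely \<open>n \<mapsto> Z T n\<close> is monotone. For a monotone map the consecutive pattern says no
  more than that the particles started next to the walls, at the sites
  \<open>s\<^sub>1 \<le> \<dots> \<le> s\<^sub>2\<^sub>k\<close>, end at \<open>y\<^sub>0, y\<^sub>1, y\<^sub>1, y\<^sub>2, y\<^sub>2, \<dots>, y\<^sub>k\<close>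
  (\<open>contains_pattern_iff_endpoints\<close>). Let \<open>v\<close> be the map that sends an endpoint \<open>z\<close> to the vector
  of the indicators \<open>[z \<in> S\<^sub>j]\<close>, where \<open>S\<^sub>j\<close> is a point or a half-line depending on the
  column, and let \<open>\<epsilon>\<close> be the matrix of Iverson brackets. If \<open>z\<^sub>1 \<le> \<dots> \<le> z\<^sub>2\<^sub>k\<close>, then the
  determinant with rows \<open>v(z\<^sub>i) - \<epsilon>\<^sub>i\<close> is the indicator of the required endpoints
  (\<open>row_det_pattern\<close>): it is lower unitriangular at these endpoints and has a large block of zeros
  otherwise. The pattern probability is therefore the expectation of this determinant at the
  endpoints \<open>z\<^sub>i = Z T s\<^sub>i\<close>, and the matrix in the theorem has the rows \<open>E v - \<epsilon>\<^sub>i\<close>, where \<open>E\<close> is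
  the expectation over one path started at \<open>s\<^sub>i\<close>.

  What remains is the identity \<open>integral_row_det_coalesce\<close>: for coalescing particles the
  expectation of \<open>det (v(Z T s\<^sub>i) - \<epsilon>\<^sub>i)\<close> is \<open>det (E v - \<epsilon>\<^sub>i)\<close>. It holds for all \<open>\<epsilon>\<close> and all sets
  \<open>S\<^sub>j\<close>, for the following reason. If several rows are driven by the same path, their
  differences are constant, so that the determinant is an affine function of the vector of that path
  (\<open>row_det_affine\<close>). The expectation over independent paths may hence be
  taken inside the determinant, however the rows are distributed over the paths
  (\<open>integral_PiM_row_det\<close>). Conditionally on the past up to time \<open>d\<close>, the expected determinant thus
  depends only on the positions that the particles occupy at time \<open>d\<close>. Merging particles that
  are at the same site at time \<open>d\<close> leaves these positions, and so the
  expectation, unchanged (\<open>integral_row_det_drivers_eq\<close>).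

  This argument allows mergers at finitely many times only, which is enough. The driving
  paths are step functions with finitely many jumps, so on every fine time grid containing the
  final time, merging at the grid times leads to the same final positions as merging in
  continuous time (\<open>coalesce_list_eq_driver\<close>, \<open>coalesce_eq_driver_eventually\<close>). Dominated convergence
  gives the identity. The monotonicity of \<open>n \<mapsto> Z T n\<close> comes from the Karlin--McGregor
  assumption, applied to pairs of paths (\<open>AE_coalesce_pair_ordered\<close>).
\<close>

section \<open>Determinants whose rows share a vector\<close>

lemma permutes_lt: "p permutes {0..<n} \<Longrightarrow> i < n \<Longrightarrow> p i < (n::nat)"
  by (metis atLeast0LessThan lessThan_iff permutes_in_image)

text \<open>
  The zero block has \<open>p\<close> rows and \<open>q\<close> columns with \<open>p + q = n + 1\<close>, so every permutation meets it:
  \<open>p\<close> rows cannot be sent injectively into the \<open>p - 1\<close> remaining columns.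
\<close>

lemma det_eq_0_if_zero_block:
  fixes f :: "nat \<Rightarrow> nat \<Rightarrow> real"
  assumes "i < n"
    and zero: "(\<forall>p j. i \<le> p \<and> p < n \<and> j \<le> i \<longrightarrow> f p j = 0) \<or>
               (\<forall>p j. p \<le> i \<and> i \<le> j \<and> j < n \<longrightarrow> f p j = 0)"
  shows "Determinant.det (Matrix.mat n n (\<lambda>(i, j). f i j)) = 0"
proof -
  have "(\<Prod>p = 0..<n. f p (q p)) = 0" if q: "q permutes {0..<n}" for q
  proof (rule ccontr)
    assume "(\<Prod>p = 0..<n. f p (q p)) \<noteq> 0"
    then have nz: "f p (q p) \<noteq> 0" if "p < n" for p
      using that by auto
    have qn: "q p < n" if "p < n" for p
      using permutes_in_image[OF q, of p] that by auto
    have inj: "inj_on q S" for S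
      using permutes_inj[OF q] inj_on_subset by blast
    from zero show False
    proof
      assume z: "\<forall>p j. i \<le> p \<and> p < n \<and> j \<le> i \<longrightarrow> f p j = 0"
      have "q ` {i..<n} \<subseteq> {Suc i..<n}"
      proof
        fix j assume "j \<in> q ` {i..<n}"
        then obtain p where "i \<le> p" "p < n" "j = q p" by auto
        with z[rule_format, of p j] nz[of p] qn[of p] show "j \<in> {Suc i..<n}" by force
      qed
      then have "card {i..<n} \<le> card {Suc i..<n}"
        by (rule card_inj_on_le[OF inj]) simp
      with \<open>i < n\<close> show False by simp
    next
      assume z: "\<forall>p j. p \<le> i \<and> i \<le> j \<and> j < n \<longrightarrow> f p j = 0"
      have "q ` {..i} \<subseteq> {..<i}"
      proof
        fix j assume "j \<in> q ` {..i}"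
        then obtain p where "p \<le> i" "j = q p" by auto
        with z[rule_format, of p j] nz[of p] qn[of p] \<open>i < n\<close> show "j \<in> {..<i}" by force
      qed
      then have "card {..i} \<le> card {..<i}"
        by (rule card_inj_on_le[OF inj]) simp
      then show False by simp
    qed
  qed
  then show ?thesis
    by (subst det_def'[of _ n]) (auto intro!: sum.neutral)
qed

text \<open>
  Functions on index pairs can be updated row by row, which keeps the determinants below free of
  matrix dimensions.
\<close>

definition row_det :: "nat \<Rightarrow> (nat \<Rightarrow> nat \<Rightarrow> real) \<Rightarrow> real" where
  "row_det n R = Determinant.det (Matrix.mat n n (\<lambda>(i, j). R i j))"

lemma row_det_cong:
  "(\<And>i j. i < n \<Longrightarrow> j < n \<Longrightarrow> R i j = R' i j) \<Longrightarrow> row_det n R = row_det n R'"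
  unfolding row_det_def by (rule arg_cong[where f = Determinant.det]) (auto intro!: eq_matI)

lemma row_det_expand:
  "row_det n R = (\<Sum>p | p permutes {0..<n}. signof p * (\<Prod>i = 0..<n. R i (p i)))"
  unfolding row_det_def
  by (subst det_def'[of _ n])
     (auto intro!: sum.cong arg_cong2[where f = "(*)"] prod.cong simp: permutes_lt)

lemma row_det_addrow:
  assumes "k < n" "l < n" "k \<noteq> l"
  shows "row_det n R = row_det n (R(k := \<lambda>j. R k j + c * R l j))"
proof -
  have "row_det n (R(k := \<lambda>j. R k j + c * R l j)) =
      Determinant.det (addrow c k l (Matrix.mat n n (\<lambda>(i, j). R i j)))"
    unfolding row_det_def using assms
    by (intro arg_cong[where f = Determinant.det] eq_matI) (auto simp: mat_addrow_def)
  also have "\<dots> = row_det n R"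
    unfolding row_det_def using assms by (subst det_addrow[of _ n]) auto
  finally show ?thesis ..
qed

text \<open>
  The determinant would have degree \<open>card S\<close> in \<open>u\<close>, but subtracting the row \<open>l\<close> from another row
  \<open>k\<close> in \<open>S\<close> turns the latter into the constant \<open>\<epsilon> l - \<epsilon> k\<close>. When only one row is left that
  depends on \<open>u\<close>, its expansion is affine.
\<close>

lemma row_det_affine:
  assumes "S \<subseteq> {..<n}"
  shows "\<exists>\<alpha> \<beta>. \<forall>u. row_det n (\<lambda>i. if i \<in> S then (\<lambda>j. u j - \<epsilon> i j) else R i) =
           \<alpha> + (\<Sum>j<n. \<beta> j * u j)"
  using assms
proof (induction "card S" arbitrary: S R)
  case 0
  then have "S = {}" using finite_subset by fastforce
  then show ?case by (intro exI[of _ "row_det n R"] exI[of _ "\<lambda>_. 0"]) simp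
next
  case (Suc m)
  then have fin: "finite S" using finite_subset by blast
  from Suc.hyps obtain k where k: "k \<in> S" by fastforce
  then have kn: "k < n" using Suc.prems by auto
  show ?case
  proof (cases "S = {k}")
    case True
    let ?A = "\<lambda>u. Matrix.mat n n (\<lambda>(i, j). (if i = k then (\<lambda>j. u j - \<epsilon> i j) else R i) j) :: real mat"
    have cof: "cofactor (?A u) k j = cofactor (?A (\<lambda>_. 0)) k j" if "j < n" for u j
    proof -
      have "mat_delete (?A u) k j = mat_delete (?A (\<lambda>_. 0)) k j"
        using kn that by (intro eq_matI) (auto simp: mat_delete_def)
      then show ?thesis by (simp add: cofactor_def)
    qed
    have "row_det n (\<lambda>i. if i \<in> S then (\<lambda>j. u j - \<epsilon> i j) else R i) =
        (\<Sum>j<n. (u j - \<epsilon> k j) * cofactor (?A (\<lambda>_. 0)) k j)" for u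
    proof -
      have "row_det n (\<lambda>i. if i \<in> S then (\<lambda>j. u j - \<epsilon> i j) else R i) = Determinant.det (?A u)"
        unfolding row_det_def True by simp
      also have "\<dots> = (\<Sum>j<n. ?A u $$ (k, j) * cofactor (?A u) k j)"
        by (rule laplace_expansion_row[OF _ kn]) simp
      also have "\<dots> = (\<Sum>j<n. (u j - \<epsilon> k j) * cofactor (?A (\<lambda>_. 0)) k j)"
      proof (rule sum.cong[OF refl])
        fix j assume "j \<in> {..<n}"
        then show "?A u $$ (k, j) * cofactor (?A u) k j =
            (u j - \<epsilon> k j) * cofactor (?A (\<lambda>_. 0)) k j"
          using cof[of j u] kn by simp
      qed
      finally show ?thesis .
    qed
    then show ?thesis
      by (intro exI[of _ "- (\<Sum>j<n. \<epsilon> k j * cofactor (?A (\<lambda>_. 0)) k j)"]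
                exI[of _ "\<lambda>j. cofactor (?A (\<lambda>_. 0)) k j"])
         (simp add: left_diff_distrib sum_subtractf mult.commute)
  next
    case False
    with k obtain l where l: "l \<in> S" "l \<noteq> k" by blast
    then have ln: "l < n" using Suc.prems by auto
    let ?R = "R(k := \<lambda>j. \<epsilon> l j - \<epsilon> k j)"
    have "row_det n (\<lambda>i. if i \<in> S then (\<lambda>j. u j - \<epsilon> i j) else R i) =
          row_det n (\<lambda>i. if i \<in> S - {k} then (\<lambda>j. u j - \<epsilon> i j) else ?R i)" for u
      using row_det_addrow[OF kn ln l(2)[symmetric],
          of "\<lambda>i. if i \<in> S then (\<lambda>j. u j - \<epsilon> i j) else R i" "-1"] k l
      by (auto intro!: arg_cong[where f = "row_det n"])
    moreover have "m = card (S - {k})" "S - {k} \<subseteq> {..<n}"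
      using Suc k fin by auto
    ultimately show ?thesis using Suc.hyps(1)[of "S - {k}" ?R] by simp
  qed
qed

text \<open>
  The form in which affinity is integrated: the row \<open>i\<close> is driven by the label \<open>\<rho> i\<close>, and only the
  vector of the label \<open>a\<close> varies.
\<close>

lemma row_det_affine_in_label:
  "\<exists>\<alpha> \<beta>. \<forall>u. row_det n (\<lambda>i j. (U(a := u)) (\<rho> i) j - \<epsilon> i j) = \<alpha> + (\<Sum>j<n. \<beta> j * u j)"
proof -
  let ?S = "{i. i < n \<and> \<rho> i = a}"
  have "row_det n (\<lambda>i j. (U(a := u)) (\<rho> i) j - \<epsilon> i j) =
      row_det n (\<lambda>i. if i \<in> ?S then (\<lambda>j. u j - \<epsilon> i j) else (\<lambda>j. U (\<rho> i) j - \<epsilon> i j))" for u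
    by (rule row_det_cong) auto
  then show ?thesis
    using row_det_affine[of ?S n \<epsilon> "\<lambda>i j. U (\<rho> i) j - \<epsilon> i j"] by auto
qed

lemma row_det_bounded:
  assumes "\<And>i j. i < n \<Longrightarrow> j < n \<Longrightarrow> \<bar>R i j\<bar> \<le> K i j"
  shows "\<bar>row_det n R\<bar> \<le> (\<Sum>p | p permutes {0..<n}. \<Prod>i = 0..<n. K i (p i))"
  unfolding row_det_expand
proof (rule order_trans[OF sum_abs sum_mono])
  fix p assume "p \<in> {p. p permutes {0..<n}}"
  then have "p i < n" if "i < n" for i
    using that by (auto simp: permutes_lt)
  then show "\<bar>signof p * (\<Prod>i = 0..<n. R i (p i))\<bar> \<le> (\<Prod>i = 0..<n. K i (p i))"
    by (auto simp: abs_mult abs_prod sign_def intro!: prod_mono assms)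
qed

text \<open>
  The column \<open>j\<close>, counted from 0, of the matrix tests whether the endpoint lies in \<open>column_set y j\<close>
  and subtracts \<open>column_shift i j\<close>. The last column is of the point type because its index
  \<open>2 k - 1\<close> is odd.
\<close>

definition column_set :: "(nat \<Rightarrow> int) \<Rightarrow> nat \<Rightarrow> int set" where
  "column_set y j = (if j = 0 \<or> odd j then {y (Suc j div 2)} else {..y (Suc j div 2)})"

definition column_shift :: "nat \<Rightarrow> nat \<Rightarrow> real" where
  "column_shift i j = of_bool (j \<noteq> 0 \<and> even j \<and> i < j)"

text \<open>
  The required endpoints \<open>h i = y (Suc i div 2)\<close> increase weakly. If \<open>z i > h i\<close>, the rows from \<open>i\<close>
  on vanish in the columns up to \<open>i\<close>; if \<open>z i < h i\<close>, the rows up to \<open>i\<close> vanish in the columns from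
  \<open>i\<close> on.
\<close>

lemma row_det_pattern:
  fixes z y :: "nat \<Rightarrow> int"
  assumes k: "k \<ge> 1" and y: "strict_mono_on {0..k} y"
    and z: "\<And>i j. i \<le> j \<Longrightarrow> j < 2 * k \<Longrightarrow> z i \<le> z j"
  shows "row_det (2 * k) (\<lambda>i j. of_bool (z i \<in> column_set y j) - column_shift i j) =
         of_bool (\<forall>i<2 * k. z i = y (Suc i div 2))"
proof -
  let ?f = "\<lambda>i j. of_bool (z i \<in> column_set y j) - column_shift i j :: real"
  let ?h = "\<lambda>i. y (Suc i div 2)"
  have ymono: "y l \<le> y m" if "l \<le> m" "m \<le> k" for l m
    using strict_mono_on_leD[OF y] that by auto
  have yless: "y l < y m" if "l < m" "m \<le> k" for l m
    using strict_mono_onD[OF y] that by auto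
  have hmono: "?h i \<le> ?h j" if "i \<le> j" "j < 2 * k" for i j
    using that by (intro ymono div_le_mono) auto
  consider (eq) "\<forall>i<2 * k. z i = ?h i"
    | (gt) i where "i < 2 * k" "z i > ?h i"
    | (lt) i where "i < 2 * k" "z i < ?h i"
    by (meson linorder_neqE)
  then show ?thesis
  proof cases
    case eq
    let ?A = "Matrix.mat (2 * k) (2 * k) (\<lambda>(i, j). ?f i j)"
    have le: "y l = y m \<longleftrightarrow> l = m" if "l \<le> k" "m \<le> k" for l m
      using yless[of l m] yless[of m l] that by (cases l m rule: linorder_cases) auto
    have lower: "?f i j = 0" if ij: "i < j" "j < 2 * k" for i j
    proof (cases "odd j")
      case True
      then have "Suc i div 2 < Suc j div 2" using ij by (auto elim!: oddE)
      moreover have "Suc j div 2 \<le> k" using ij by simp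
      ultimately have "?h i < ?h j" by (rule yless)
      with True eq ij
      show ?thesis by (auto simp: column_set_def column_shift_def)
    next
      case False
      with hmono[of i j] eq ij show ?thesis by (auto simp: column_set_def column_shift_def)
    qed
    have diag: "?f i i = 1" if "i < 2 * k" for i
      using eq that by (auto simp: column_set_def column_shift_def)
    have "Determinant.det ?A = prod_list (diag_mat ?A)"
      by (rule det_lower_triangular[of "2 * k"]) (simp_all add: lower)
    also have "diag_mat ?A = map (\<lambda>i. 1) [0..<2 * k]"
      unfolding diag_mat_def by (auto simp: diag)
    also have "prod_list \<dots> = 1" by (simp add: map_replicate_const)
    finally show ?thesis using eq by (simp add: row_det_def)
  next
    case gt
    have "?f p j = 0" if pj: "i \<le> p" "p < 2 * k" "j \<le> i" for p j
      using z[of i p] hmono[of j i] gt pj by (auto simp: column_set_def column_shift_def)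
    then have "row_det (2 * k) ?f = 0"
      unfolding row_det_def by (intro det_eq_0_if_zero_block[OF gt(1)]) blast
    with gt show ?thesis by auto
  next
    case lt
    \<comment> \<open>In a column of the half-line type the diagonal entry does not vanish. As \<open>h (i - 1) = h i\<close>
      for even \<open>i > 0\<close>, the preceding index serves as well.\<close>
    define i' where "i' = (if i \<noteq> 0 \<and> even i then i - 1 else i)"
    have i': "i' < 2 * k" "i' = 0 \<or> odd i'" "z i' < ?h i'"
    proof -
      show "i' < 2 * k" "i' = 0 \<or> odd i'" using lt(1) by (auto simp: i'_def)
      have "?h i' = ?h i" by (auto simp: i'_def elim!: evenE)
      moreover have "z i' \<le> z i" using z lt(1) by (auto simp: i'_def)
      ultimately show "z i' < ?h i'" using lt(2) by simp
    qed
    have "?f p j = 0" if pj: "p \<le> i'" "i' \<le> j" "j < 2 * k" for p j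
    proof -
      have "z p < ?h j" using z[of p i'] hmono[of i' j] i' pj by linarith
      moreover have "p < j" if "j \<noteq> 0" "even j" using i'(2) pj that by (cases "p = j") auto
      ultimately show ?thesis by (auto simp: column_set_def column_shift_def)
    qed
    then have "row_det (2 * k) ?f = 0"
      unfolding row_det_def by (intro det_eq_0_if_zero_block[OF i'(1)]) blast
    with lt show ?thesis by auto
  qed
qed

section \<open>Coalescence of step paths\<close>

text \<open>
  The function can change only at a point of \<open>P\<close>, where it already takes its new value. Thus a
  path is known on each interval between breakpoints from its value at the left end.
\<close>

definition step_on :: "real set \<Rightarrow> real \<Rightarrow> (real \<Rightarrow> int) \<Rightarrow> bool" where
  "step_on P T f \<longleftrightarrow> (\<forall>u v. 0 \<le> u \<and> u \<le> v \<and> v \<le> T \<and> P \<inter> {u<..v} = {} \<longrightarrow> f u = f v)"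

text \<open>Paths that have met stay together; this makes the position in \<open>merge_path\<close> unique.\<close>

definition coalescing :: "real \<Rightarrow> (real \<Rightarrow> int) set \<Rightarrow> bool" where
  "coalescing T C \<longleftrightarrow>
     (\<forall>g\<in>C. \<forall>h\<in>C. \<forall>u v. 0 \<le> u \<and> u \<le> v \<and> v \<le> T \<and> g u = h u \<longrightarrow> g v = h v)"

lemma step_onD: "step_on P T f \<Longrightarrow> 0 \<le> u \<Longrightarrow> u \<le> v \<Longrightarrow> v \<le> T \<Longrightarrow> P \<inter> {u<..v} = {} \<Longrightarrow> f u = f v"
  unfolding step_on_def by blast

lemma coalescingD:
  "coalescing T C \<Longrightarrow> g \<in> C \<Longrightarrow> h \<in> C \<Longrightarrow> g u = h u \<Longrightarrow> 0 \<le> u \<Longrightarrow> u \<le> v \<Longrightarrow> v \<le> T \<Longrightarrow> g v = h v"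
  unfolding coalescing_def by blast

lemma step_on_mono: "step_on P T f \<Longrightarrow> P \<subseteq> Q \<Longrightarrow> t \<le> T \<Longrightarrow> step_on Q t f"
  unfolding step_on_def by (meson disjoint_iff order_trans subsetD)

text \<open>
  Around each time the path has at most one breakpoint, by right-continuity and the existence of left
  limits. Compactness of the time interval, in the form of the bisection principle \<open>Bolzano\<close>, leaves
  finitely many.
\<close>

lemma skip_free_path_step_on:
  assumes w: "w \<in> skip_free_paths T" and "0 \<le> T"
  shows "\<exists>P. finite P \<and> step_on P T w"
proof -
  define Q where "Q a b \<longleftrightarrow> (\<exists>P. finite P \<and>
    (\<forall>u v. a \<le> u \<and> 0 \<le> u \<and> u \<le> v \<and> v \<le> b \<and> v \<le> T \<and> P \<inter> {u<..v} = {} \<longrightarrow> w u = w v))" for a b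
  from \<open>0 \<le> T\<close> have "Q 0 T"
  proof (induction rule: Bolzano)
    case (trans a b c)
    obtain P1 where P1: "finite P1" "\<forall>u v. a \<le> u \<and> 0 \<le> u \<and> u \<le> v \<and> v \<le> b \<and> v \<le> T \<and> P1 \<inter> {u<..v} = {} \<longrightarrow> w u = w v"
      using trans(1) unfolding Q_def by (elim exE conjE)
    obtain P2 where P2: "finite P2" "\<forall>u v. b \<le> u \<and> 0 \<le> u \<and> u \<le> v \<and> v \<le> c \<and> v \<le> T \<and> P2 \<inter> {u<..v} = {} \<longrightarrow> w u = w v"
      using trans(2) unfolding Q_def by (elim exE conjE)
    have un: "w u = w v" if uv: "a \<le> u" "0 \<le> u" "u \<le> v" "v \<le> c" "v \<le> T" "(P1 \<union> P2) \<inter> {u<..v} = {}" for u v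
    proof -
      consider "v \<le> b" | "b \<le> u" | "u \<le> b" "b \<le> v" by linarith
      then show ?thesis
      proof cases
        case 1
        show ?thesis by (rule P1(2)[rule_format]) (use uv 1 in auto)
      next
        case 2
        show ?thesis by (rule P2(2)[rule_format]) (use uv 2 in auto)
      next
        case 3
        have "w u = w b" by (rule P1(2)[rule_format]) (use uv 3 in auto)
        also have "w b = w v" by (rule P2(2)[rule_format]) (use uv 3 in auto)
        finally show ?thesis .
      qed
    qed
    show ?case unfolding Q_def
      by (intro exI[of _ "P1 \<union> P2"] conjI allI impI) (use P1(1) P2(1) in simp, clarify, rule un)
  next
    case (local x)
    have "\<exists>e>x. \<forall>u. x \<le> u \<and> u < e \<and> u \<le> T \<longrightarrow> w u = w x"
    proof (cases "x < T")
      case True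
      then have "\<forall>\<^sub>F u in at_right x. w u = w x"
        using w local unfolding skip_free_paths_def by auto
      then obtain e where "e > x" "\<forall>u>x. u < e \<longrightarrow> w u = w x"
        unfolding eventually_at_right[OF True] by auto
      then show ?thesis by (intro exI[of _ e]) (auto simp: le_less)
    next
      case False
      then show ?thesis by (intro exI[of _ "x + 1"]) (use local in force)
    qed
    then obtain e where e: "e > x" "\<And>u. x \<le> u \<Longrightarrow> u < e \<Longrightarrow> u \<le> T \<Longrightarrow> w u = w x" by blast
    have "\<exists>z. \<exists>l<x. \<forall>u. 0 \<le> u \<and> l < u \<and> u < x \<longrightarrow> w u = z"
    proof (cases "0 < x")
      case True
      then obtain z where "\<forall>\<^sub>F u in at_left x. w u = z"
        using w local unfolding skip_free_paths_def by fastforce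
      then obtain l where "l < x" "\<forall>u>l. u < x \<longrightarrow> w u = z"
        unfolding eventually_at_left[OF True] by auto
      then show ?thesis by blast
    next
      case False
      then show ?thesis by (intro exI[of _ 0] exI[of _ "x - 1"]) auto
    qed
    then obtain z l where l: "l < x" "\<And>u. 0 \<le> u \<Longrightarrow> l < u \<Longrightarrow> u < x \<Longrightarrow> w u = z" by blast
    show ?case
    proof (intro exI[of _ "min (e - x) (x - l)"] conjI allI impI)
      show "0 < min (e - x) (x - l)" using e l by simp
      fix a b assume ab: "a \<le> x \<and> x \<le> b \<and> b - a < min (e - x) (x - l)"
      have "w u = w v" if uv: "a \<le> u" "0 \<le> u" "u \<le> v" "v \<le> b" "v \<le> T" "{x} \<inter> {u<..v} = {}" for u v
      proof (cases "v < x")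
        case True
        then show ?thesis using l(2)[of u] l(2)[of v] uv ab by auto
      next
        case False
        then have "x \<le> u" using uv by auto
        then show ?thesis using e(2)[of u] e(2)[of v] uv ab by auto
      qed
      then show "Q a b" unfolding Q_def by (intro exI[of _ "{x}"] conjI allI impI) (simp, clarify)
    qed
  qed
  then show ?thesis unfolding Q_def step_on_def by simp
qed

lemma last_breakpoint:
  fixes P :: "real set"
  assumes "finite P" "0 \<in> P" "0 \<le> s"
  obtains p where "p \<in> P" "0 \<le> p" "p \<le> s" "P \<inter> {p<..s} = {}"
proof
  let ?p = "Max (P \<inter> {0..s})"
  have fin: "finite (P \<inter> {0..s})" "P \<inter> {0..s} \<noteq> {}" using assms by auto
  from Max_in[OF this] show "?p \<in> P" "0 \<le> ?p" "?p \<le> s" by auto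
  show "P \<inter> {?p<..s} = {}"
    using Max_ge[OF fin(1)] \<open>0 \<le> ?p\<close> by fastforce
qed

text \<open>
  If the path meets the family at all, it does so at a breakpoint, because everything is constant
  in between. There are finitely many breakpoints, so a first meeting time exists.
\<close>

lemma merge_path_cases [consumes 5, case_names apart meet]:
  assumes P: "finite P" "0 \<in> P"
    and C: "\<forall>g\<in>C. step_on P T g" "coalescing T C"
    and w: "step_on P T w"
  obtains
    (apart) "\<And>s g. 0 \<le> s \<Longrightarrow> s \<le> T \<Longrightarrow> g \<in> C \<Longrightarrow> g s \<noteq> w s"
      "\<And>s. 0 \<le> s \<Longrightarrow> s \<le> T \<Longrightarrow> merge_path C w s = w s"
  | (meet) u g where "u \<in> P" "0 \<le> u" "u \<le> T" "g \<in> C" "g u = w u"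
      "\<And>s h. 0 \<le> s \<Longrightarrow> s < u \<Longrightarrow> h \<in> C \<Longrightarrow> h s \<noteq> w s"
      "\<And>s. 0 \<le> s \<Longrightarrow> s < u \<Longrightarrow> merge_path C w s = w s"
      "\<And>s. u \<le> s \<Longrightarrow> s \<le> T \<Longrightarrow> merge_path C w s = g s"
proof -
  let ?H = "{p \<in> P. 0 \<le> p \<and> p \<le> T \<and> (\<exists>g\<in>C. g p = w p)}"
  have H: "\<exists>p\<in>?H. p \<le> s" if s: "0 \<le> s" "s \<le> T" "g \<in> C" "g s = w s" for s g
  proof -
    obtain p where p: "p \<in> P" "0 \<le> p" "p \<le> s" "P \<inter> {p<..s} = {}"
      using last_breakpoint[OF P s(1)] by metis
    have "g p = g s" using C(1)[rule_format, OF s(3)] p(2,3) s(2) p(4) by (rule step_onD)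
    moreover have "w p = w s" using w p(2,3) s(2) p(4) by (rule step_onD)
    ultimately have "g p = w p" using s by simp
    then show ?thesis using p s by force
  qed
  have no_meet: "merge_path C w s = w s" if "\<forall>u\<in>{0..s}. \<forall>g\<in>C. g u \<noteq> w u" for s
    using that unfolding merge_path_def by auto
  show thesis
  proof (cases "?H = {}")
    case True
    then have *: "g s \<noteq> w s" if "0 \<le> s" "s \<le> T" "g \<in> C" for s g using H that by blast
    show thesis by (rule apart) (use * no_meet in auto)
  next
    case False
    define u where "u = Min ?H"
    have fin: "finite ?H" using P by simp
    have "u \<in> ?H" unfolding u_def by (rule Min_in[OF fin False])
    then obtain g where u: "u \<in> P" "0 \<le> u" "u \<le> T" "g \<in> C" "g u = w u" by auto
    have before: "h s \<noteq> w s" if bs: "0 \<le> s" "s < u" "h \<in> C" for s h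
    proof
      assume "h s = w s"
      moreover have "s \<le> T" using bs u by simp
      ultimately obtain p where "p \<in> ?H" "p \<le> s" using H[of s h] bs by blast
      then show False using Min_le[OF fin, of p] bs unfolding u_def by linarith
    qed
    have "merge_path C w s = g s" if s: "u \<le> s" "s \<le> T" for s
    proof -
      let ?Z = "\<lambda>z. \<exists>g\<in>C. z = g s \<and>
             (\<exists>u\<in>{0..s}. g u = w u \<and> (\<forall>v\<in>{0..<u}. \<forall>h\<in>C. h v \<noteq> w v))"
      have "merge_path C w s = (THE z. ?Z z)"
        unfolding merge_path_def using u s by (subst if_P) auto
      also have "\<dots> = g s"
      proof (rule the_equality)
        show "?Z (g s)"
          using u s before by (intro bexI[of _ g] conjI bexI[of _ u] refl) auto
        fix z assume "?Z z"
        then obtain h v where h: "h \<in> C" "z = h s" "0 \<le> v" "v \<le> s" "h v = w v"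
          "\<And>t h. 0 \<le> t \<Longrightarrow> t < v \<Longrightarrow> h \<in> C \<Longrightarrow> h t \<noteq> w t" by auto
        have "v = u" using h(6)[of u g] before[of v h] h u by (cases u v rule: linorder_cases) auto
        then show "z = g s" using coalescingD[OF C(2), of h g u s] h u s by simp
      qed
      finally show ?thesis .
    qed
    then show thesis using u before no_meet by (intro meet[of u g]) auto
  qed
qed

lemma merge_path_step_coalescing:
  assumes "finite P" "0 \<in> P"
    and C: "\<forall>g\<in>C. step_on P T g" "coalescing T C"
    and w: "step_on P T w"
  shows "step_on P T (merge_path C w)" "coalescing T (insert (merge_path C w) C)"
proof -
  let ?m = "merge_path C w"
  have both: "step_on P T ?m \<and> (\<forall>g\<in>C. \<forall>u v. 0 \<le> u \<and> u \<le> v \<and> v \<le> T \<and> ?m u = g u \<longrightarrow> ?m v = g v)"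
    using assms
  proof (cases rule: merge_path_cases)
    case apart
    have "step_on P T ?m"
      unfolding step_on_def
    proof (intro allI impI)
      fix u v assume "0 \<le> u \<and> u \<le> v \<and> v \<le> T \<and> P \<inter> {u<..v} = {}"
      then show "?m u = ?m v" using apart(2)[of u] apart(2)[of v] step_onD[OF w, of u v] by auto
    qed
    moreover have "?m v = g v" if "g \<in> C" "0 \<le> u" "u \<le> v" "v \<le> T" "?m u = g u" for g u v
      using apart(1)[of u g] apart(2)[of u] that by auto
    ultimately show ?thesis by (intro conjI ballI allI impI) (assumption, metis)
  next
    case (meet u0 g0)
    have "?m u = ?m v" if uv: "0 \<le> u" "u \<le> v" "v \<le> T" "P \<inter> {u<..v} = {}" for u v
    proof -
      have "u0 \<notin> {u<..v}" using uv meet by blast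
      then consider "u0 \<le> u" | "v < u0" by fastforce
      then show ?thesis
      proof cases
        case 1
        then show ?thesis
          using meet(8)[of u] meet(8)[of v] uv step_onD[OF C(1)[rule_format, OF meet(4)], of u v] by auto
      next
        case 2
        then show ?thesis
          using meet(7)[of u] meet(7)[of v] uv step_onD[OF w, of u v] by auto
      qed
    qed
    moreover have "?m v = g v" if g: "g \<in> C" "0 \<le> u" "u \<le> v" "v \<le> T" "?m u = g u" for g u v
    proof -
      have "u0 \<le> u" using meet(6)[of u g] meet(7)[of u] g by force
      then show ?thesis
        using meet(8)[of u] meet(8)[of v] coalescingD[OF C(2) meet(4) g(1), of u v] g by auto
    qed
    ultimately show ?thesis unfolding step_on_def by (intro conjI ballI allI impI) (metis, metis)
  qed
  then show "step_on P T ?m" by simp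
  have m: "?m v = g v" if "g \<in> C" "0 \<le> u" "u \<le> v" "v \<le> T" "?m u = g u" for g u v
    using both that by blast
  show "coalescing T (insert ?m C)"
    unfolding coalescing_def
  proof (intro ballI allI impI, elim conjE)
    fix g h u v
    assume "g \<in> insert ?m C" "h \<in> insert ?m C" and uv: "0 \<le> u" "u \<le> v" "v \<le> T" "g u = h u"
    then consider "g = ?m" "h = ?m" | "g = ?m" "h \<in> C" | "g \<in> C" "h = ?m" | "g \<in> C" "h \<in> C"
      by auto
    then show "g v = h v"
    proof cases
      case 2
      then show ?thesis using m[of h u v] uv by simp
    next
      case 3
      then show ?thesis using m[of g u v] uv by simp
    next
      case 4
      then show ?thesis using coalescingD[OF C(2)] uv by simp
    qed simp
  qed
qed

lemma coalesce_list_step_coalescing: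
  assumes "finite P" "0 \<in> P" "distinct xs" "\<And>a. a \<in> set xs \<Longrightarrow> step_on P T (w a)"
  shows "(\<forall>a\<in>set xs. step_on P T (coalesce_list xs w a)) \<and>
         coalescing T (coalesce_list xs w ` set xs)"
  using assms(3,4)
proof (induction xs)
  case Nil
  then show ?case by (simp add: coalescing_def)
next
  case (Cons x xs)
  let ?C = "coalesce_list xs w ` set xs"
  have "(\<forall>a\<in>set xs. step_on P T (coalesce_list xs w a)) \<and> coalescing T ?C"
    using Cons by simp
  then have "step_on P T (merge_path ?C (w x))" "coalescing T (insert (merge_path ?C (w x)) ?C)"
    "\<forall>g\<in>?C. step_on P T g"
    using merge_path_step_coalescing[of P ?C T "w x"] assms(1,2) Cons.prems by auto
  moreover have "coalesce_list (x # xs) w ` set (x # xs) = insert (merge_path ?C (w x)) ?C"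
    using Cons.prems by auto
  ultimately show ?case by (auto simp del: coalesce_list.simps) auto
qed

text \<open>
  The position of the particle started at \<open>a\<close> is that of the driving path \<open>w (R a)\<close>. At time \<open>d\<close> all
  particles on the same site are given the driver of the rightmost of their starting sites. The
  choice of the rightmost one agrees with \<open>coalesce\<close> and makes the drivers independent of
  particles added on the left.
\<close>

definition merge_drivers ::
    "int set \<Rightarrow> (int \<Rightarrow> real \<Rightarrow> int) \<Rightarrow> real \<Rightarrow> (int \<Rightarrow> int) \<Rightarrow> int \<Rightarrow> int" where
  "merge_drivers A w d R a = R (Max {b \<in> A. w (R b) d = w (R a) d})"

definition driver :: "int set \<Rightarrow> (int \<Rightarrow> real \<Rightarrow> int) \<Rightarrow> real list \<Rightarrow> int \<Rightarrow> int" where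
  "driver A w ts = fold (merge_drivers A w) ts id"

lemma driver_Nil [simp]: "driver A w [] a = a"
  by (simp add: driver_def)

lemma driver_snoc:
  "driver A w (ts @ [d]) a = driver A w ts (Max {b \<in> A. w (driver A w ts b) d = w (driver A w ts a) d})"
  by (simp add: driver_def merge_drivers_def)

lemma driver_snoc_obtain:
  assumes "finite A" "a \<in> A"
  obtains b where "b \<in> A" "w (driver A w ts b) d = w (driver A w ts a) d"
    "driver A w (ts @ [d]) a = driver A w ts b"
proof -
  let ?S = "{b \<in> A. w (driver A w ts b) d = w (driver A w ts a) d}"
  have "Max ?S \<in> ?S" using assms by (intro Max_in) auto
  then show thesis using that driver_snoc by blast
qed

lemma driver_in: "finite A \<Longrightarrow> a \<in> A \<Longrightarrow> driver A w ts a \<in> A"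
proof (induction ts arbitrary: a rule: rev_induct)
  case (snoc d ts)
  then show ?case by (metis driver_snoc_obtain)
qed simp

lemma driver_snoc_position:
  "finite A \<Longrightarrow> a \<in> A \<Longrightarrow> w (driver A w (ts @ [d]) a) d = w (driver A w ts a) d"
  by (metis driver_snoc_obtain)

lemma driver_cong:
  assumes "finite A" "a \<in> A" "\<And>b t. b \<in> A \<Longrightarrow> t \<in> set ts \<Longrightarrow> w b t = w' b t"
  shows "driver A w ts a = driver A w' ts a"
  using assms(2,3)
proof (induction ts arbitrary: a rule: rev_induct)
  case (snoc d ts)
  have IH: "driver A w ts b = driver A w' ts b" if "b \<in> A" for b
    using snoc that by simp
  have *: "w (driver A w ts b) d = w' (driver A w' ts b) d" if "b \<in> A" for b
    using IH[OF that] driver_in[OF assms(1) that, of w' ts] snoc.prems by auto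
  have "{b \<in> A. w (driver A w ts b) d = w (driver A w ts a) d} =
        {b \<in> A. w' (driver A w' ts b) d = w' (driver A w' ts a) d}" (is "?S = _")
    using * snoc.prems by auto
  moreover have "Max ?S \<in> A" using Max_in[of ?S] assms(1) snoc.prems by auto
  ultimately show ?case by (simp add: driver_snoc IH)
qed simp

lemma Max_insert_less:
  "finite S \<Longrightarrow> b \<in> S \<Longrightarrow> x < (b::int) \<Longrightarrow> Max (insert x S) = Max S"
  by (metis Max_ge Max_insert emptyE max.absorb2 order.trans less_imp_le)

text \<open>
  A particle added on the left of all others is never the rightmost member of a cluster containing
  one of them.
\<close>

lemma driver_insert_less:
  assumes "finite A" "\<And>b. b \<in> A \<Longrightarrow> x < b" "a \<in> A"
  shows "driver (insert x A) w ts a = driver A w ts a"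
  using assms(3)
proof (induction ts arbitrary: a rule: rev_induct)
  case (snoc d ts)
  let ?S = "{b \<in> A. w (driver A w ts b) d = w (driver A w ts a) d}"
  let ?S' = "{b \<in> insert x A. w (driver (insert x A) w ts b) d = w (driver (insert x A) w ts a) d}"
  have "?S' = ?S \<or> ?S' = insert x ?S" using snoc by auto
  moreover have "Max (insert x ?S) = Max ?S"
    by (rule Max_insert_less[of _ a]) (use assms snoc.prems in simp_all)
  ultimately have "Max ?S' = Max ?S" by (elim disjE) (erule arg_cong, erule ssubst, assumption)
  moreover have "Max ?S \<in> A" using Max_in[of ?S] assms(1) snoc.prems by auto
  ultimately show ?case by (simp only: driver_snoc snoc.IH)
qed simp

lemma driver_insert_merge:
  assumes "finite A" "\<And>b. b \<in> A \<Longrightarrow> x < b" "b \<in> A"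
    and "w (driver (insert x A) w ts x) d = w (driver A w ts b) d"
  shows "driver (insert x A) w (ts @ [d]) x = driver A w (ts @ [d]) b"
proof -
  have "driver (insert x A) w (ts @ [d]) x = driver (insert x A) w (ts @ [d]) b"
    using assms by (simp add: driver_snoc driver_insert_less)
  then show ?thesis using assms by (simp add: driver_insert_less)
qed

lemma driver_insert_apart:
  assumes "finite A" "\<And>b. b \<in> A \<Longrightarrow> x < b"
    and "\<And>b. b \<in> A \<Longrightarrow> w (driver A w ts b) d \<noteq> w (driver (insert x A) w ts x) d"
  shows "driver (insert x A) w (ts @ [d]) x = driver (insert x A) w ts x"
proof -
  have "{b \<in> insert x A. w (driver (insert x A) w ts b) d = w (driver (insert x A) w ts x) d} = {x}"
    using assms driver_insert_less[OF assms(1,2)] by auto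
  then show ?thesis by (simp add: driver_snoc)
qed

text \<open>
  The grid \<open>ts\<close> is fine in the sense that from each breakpoint on, some grid time precedes the
  next breakpoint. By induction on the starting sites, only the leftmost particle \<open>x\<close> has to be
  considered. As long as \<open>x\<close> has not met the others, it is its own driver in both systems. When it
  first meets them at time \<open>u\<close>, the next grid time comes before the next breakpoint, so
  the two paths still coincide there and the drivers merge too. Between grid times the two systems
  may differ.
\<close>

lemma coalesce_list_eq_driver:
  assumes P: "finite P" "0 \<in> P"
    and ts: "sorted ts" "set ts \<subseteq> {0..T}"
    and fine: "\<And>p. p \<in> P \<Longrightarrow> 0 \<le> p \<Longrightarrow> p \<le> T \<Longrightarrow> \<exists>e\<in>set ts. p \<le> e \<and> P \<inter> {p<..e} = {}"
    and xs: "sorted xs" "distinct xs" "\<And>a. a \<in> set xs \<Longrightarrow> step_on P T (w a)"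
  shows "ts = ts1 @ d # ts2 \<Longrightarrow> a \<in> set xs \<Longrightarrow>
    coalesce_list xs w a d = w (driver (set xs) w (ts1 @ [d]) a) d"
  using xs
proof (induction xs arbitrary: ts1 ts2 d a)
  case (Cons x xs)
  let ?Z = "coalesce_list xs w" and ?D = "driver (set xs) w"
  let ?C = "?Z ` set xs"
  let ?m = "merge_path ?C (w x)"
  let ?Dx = "\<lambda>ts. driver (insert x (set xs)) w ts x"
  have less: "x < b" if "b \<in> set xs" for b
    using Cons.prems that by (auto simp: order_less_le)
  have IH: "?Z b d = w (?D (ts1 @ [d]) b) d"
    if "ts = ts1 @ d # ts2" "b \<in> set xs" for b ts1 d ts2
    using Cons.IH[OF that] Cons.prems by auto
  have C: "\<forall>g\<in>?C. step_on P T g" "coalescing T ?C"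
    using coalesce_list_step_coalescing[OF P, of xs T w] Cons.prems by auto
  have wx: "step_on P T (w x)" using Cons.prems by simp
  \<comment> \<open>Up to the grid times \<open>ts1\<close>, either \<open>x\<close> is alone in both systems, or it has the driver of some
    \<open>b\<close> and follows \<open>b\<close> from the last of these times on.\<close>
  have merge: "?Dx ts1 = x \<and> (\<forall>e\<in>set ts1. \<forall>u\<in>{0..e}. \<forall>b\<in>set xs. ?Z b u \<noteq> w x u) \<or>
      (\<exists>b\<in>set xs. ?Dx ts1 = ?D ts1 b \<and> (\<forall>s. (\<forall>e\<in>set ts1. e \<le> s) \<and> s \<in> {0..T} \<longrightarrow> ?m s = ?Z b s))"
    if "ts = ts1 @ ts2" for ts1 ts2
    using that
  proof (induction ts1 arbitrary: ts2 rule: rev_induct)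
    case (snoc d ts1)
    then have ts_eq: "ts = ts1 @ d # ts2" by simp
    have d: "0 \<le> d" "d \<le> T" "\<And>e. e \<in> set ts1 \<Longrightarrow> e \<le> d" "\<And>e. e \<in> set ts2 \<Longrightarrow> d \<le> e"
      using ts unfolding ts_eq by (auto simp: sorted_append)
    have pos: "w (?D ts1 b) d = ?Z b d" if "b \<in> set xs" for b
      using IH[OF ts_eq that] driver_snoc_position[of "set xs" b w ts1 d] that by simp
    consider (free) "?Dx ts1 = x" "\<forall>e\<in>set ts1. \<forall>u\<in>{0..e}. \<forall>b\<in>set xs. ?Z b u \<noteq> w x u"
      | (merged) b where "b \<in> set xs" "?Dx ts1 = ?D ts1 b"
          "\<forall>s. (\<forall>e\<in>set ts1. e \<le> s) \<and> s \<in> {0..T} \<longrightarrow> ?m s = ?Z b s"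
      using snoc.IH[OF ts_eq] by (elim disjE conjE bexE)
    then show ?case
    proof cases
      case merged
      have "?Dx (ts1 @ [d]) = ?D (ts1 @ [d]) b"
        by (rule driver_insert_merge) (use merged less in auto)
      with merged show ?thesis by (intro disjI2 bexI[of _ b]) auto
    next
      case free
      have still_free: ?thesis if none: "\<And>u b. 0 \<le> u \<Longrightarrow> u \<le> d \<Longrightarrow> b \<in> set xs \<Longrightarrow> ?Z b u \<noteq> w x u"
      proof -
        have "?Dx (ts1 @ [d]) = ?Dx ts1"
          by (rule driver_insert_apart) (use less pos none d free in auto)
        then show ?thesis using free(1) none d(3) by (intro disjI1) (force intro: order_trans)
      qed
      from P C wx show ?thesis
      proof (cases rule: merge_path_cases)
        case apart
        show ?thesis by (rule still_free) (use apart(1) d in auto)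
      next
        case (meet u g)
        show ?thesis
        proof (cases "u \<le> d")
          case False
          show ?thesis by (rule still_free) (use meet(6) False in auto)
        next
          case True
          obtain b where b: "b \<in> set xs" "g = ?Z b" using meet by auto
          obtain e where e: "e \<in> set ts" "u \<le> e" "P \<inter> {u<..e} = {}"
            using fine[of u] meet by auto
          have "e \<notin> set ts1"
          proof
            assume "e \<in> set ts1"
            moreover have "u \<in> {0..e}" using meet(2) e(2) by simp
            ultimately have "?Z b u \<noteq> w x u" using free(2) b(1) by blast
            then show False using meet(5) b(2) by simp
          qed
          then have "d \<le> e" using e(1) d(4) unfolding ts_eq by auto
          then have Pd: "P \<inter> {u<..d} = {}" using e(3) by auto
          have "w x d = w x u" using step_onD[OF wx meet(2) True d(2) Pd] by simp
          also have "\<dots> = ?Z b d"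
            using step_onD[OF C(1)[rule_format, OF meet(4)] meet(2) True d(2) Pd] meet(5) b by simp
          finally have "?Dx (ts1 @ [d]) = ?D (ts1 @ [d]) b"
            by (intro driver_insert_merge) (use less free(1) pos b in auto)
          moreover have "?m s = ?Z b s" if "d \<le> s" "s \<le> T" for s
            using meet(8)[of s] that True b by simp
          ultimately show ?thesis using b by (intro disjI2 bexI[of _ b]) auto
        qed
      qed
    qed
  qed simp
  show ?case
  proof (cases "a = x")
    case False
    then have "a \<in> set xs" using Cons.prems by simp
    then show ?thesis
      using IH[OF Cons.prems(1)] False less by (simp add: driver_insert_less)
  next
    case True
    have d: "0 \<le> d" "d \<le> T" "\<forall>e\<in>set (ts1 @ [d]). e \<le> d"
      using ts unfolding Cons.prems(1) by (auto simp: sorted_append)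
    have "?m d = w (?Dx (ts1 @ [d])) d"
      using merge[of "ts1 @ [d]" ts2, unfolded append.simps append_assoc, OF Cons.prems(1)]
    proof (elim disjE conjE bexE)
      assume "?Dx (ts1 @ [d]) = x"
        and *: "\<forall>e\<in>set (ts1 @ [d]). \<forall>u\<in>{0..e}. \<forall>b\<in>set xs. ?Z b u \<noteq> w x u"
      moreover have "?m d = w x d" unfolding merge_path_def using * by (subst if_not_P) auto
      ultimately show ?thesis by simp
    next
      fix b
      assume b: "b \<in> set xs" "?Dx (ts1 @ [d]) = ?D (ts1 @ [d]) b"
        and *: "\<forall>s. (\<forall>e\<in>set (ts1 @ [d]). e \<le> s) \<and> s \<in> {0..T} \<longrightarrow> ?m s = ?Z b s"
      have "?m d = ?Z b d" using * d by simp
      then show ?thesis using IH[OF Cons.prems(1) b(1)] b(2) by simp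
    qed
    with True show ?thesis by simp
  qed
qed simp

section \<open>Coalescence on a fine time grid\<close>

text \<open>The end point \<open>t\<close> has to be a grid time, since particles may first meet at time \<open>t\<close> itself.\<close>

definition grid :: "real \<Rightarrow> nat \<Rightarrow> real list" where
  "grid t n = map (\<lambda>k. real k * t / real (Suc n)) [0..<Suc (Suc n)]"

lemma grid_snoc: "grid t n = map (\<lambda>k. real k * t / real (Suc n)) [0..<Suc n] @ [t]"
  unfolding grid_def by simp

lemma sorted_grid: "0 \<le> t \<Longrightarrow> sorted (grid t n)"
  unfolding grid_def sorted_map
  by (intro sorted_wrt_mono_rel[OF _ sorted_upt]) (auto intro!: divide_right_mono mult_right_mono)

lemma set_grid: "0 \<le> t \<Longrightarrow> set (grid t n) \<subseteq> {0..t}"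
proof -
  assume t: "0 \<le> t"
  have "real k * t / real (Suc n) \<le> t" if "k \<le> Suc n" for k
  proof -
    have "real k * t \<le> real (Suc n) * t" using that t by (intro mult_right_mono) auto
    then show ?thesis by (simp add: divide_le_eq mult.commute del: of_nat_Suc)
  qed
  then show ?thesis using t unfolding grid_def by (auto simp del: upt_Suc of_nat_Suc)
qed

text \<open>
  The first grid time after \<open>p\<close> is at most one mesh width away, and the mesh width eventually
  is smaller than the distance from \<open>p\<close> to the next point of \<open>P\<close>.
\<close>

lemma grid_fine:
  assumes "finite P" "0 \<le> t"
  shows "\<forall>\<^sub>F n in sequentially. \<forall>p\<in>P. 0 \<le> p \<longrightarrow> p \<le> t \<longrightarrow>
           (\<exists>e\<in>set (grid t n). p \<le> e \<and> P \<inter> {p<..e} = {})"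
proof (intro eventually_ball_finite[OF assms(1)] ballI)
  fix p assume "p \<in> P"
  have t_in: "t \<in> set (grid t n)" for n by (simp add: grid_snoc)
  show "\<forall>\<^sub>F n in sequentially. 0 \<le> p \<longrightarrow> p \<le> t \<longrightarrow>
          (\<exists>e\<in>set (grid t n). p \<le> e \<and> P \<inter> {p<..e} = {})"
  proof (cases "0 \<le> p \<and> p < t")
    case False
    then have "0 \<le> p \<longrightarrow> p \<le> t \<longrightarrow> (\<exists>e\<in>set (grid t n). p \<le> e \<and> P \<inter> {p<..e} = {})" for n
      using t_in[of n] by (auto intro!: bexI[of _ t])
    then show ?thesis by (intro always_eventually allI)
  next
    case True
    have "\<forall>\<^sub>F n in sequentially. \<forall>q\<in>P. p < q \<longrightarrow> p + t / real (Suc n) < q"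
    proof (intro eventually_ball_finite[OF assms(1)] ballI)
      fix q assume "q \<in> P"
      have "(\<lambda>n. p + t / real (Suc n)) \<longlonglongrightarrow> p + 0"
        by (intro tendsto_intros LIMSEQ_Suc lim_const_over_n)
      then have "\<forall>\<^sub>F n in sequentially. p + t / real (Suc n) < q" if "p < q"
        using that by (intro order_tendstoD) auto
      then show "\<forall>\<^sub>F n in sequentially. p < q \<longrightarrow> p + t / real (Suc n) < q"
        by (cases "p < q") auto
    qed
    then show ?thesis
    proof eventually_elim
      case (elim n)
      define k where "k = nat \<lceil>p * real (Suc n) / t\<rceil>"
      have pos: "0 < t" "0 \<le> p * real (Suc n) / t" using True by auto
      have k: "p * real (Suc n) / t \<le> real k" "real k < p * real (Suc n) / t + 1"
        unfolding k_def using pos(2) by linarith+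
      have "p * real (Suc n) / t \<le> real (Suc n)"
        using True by (simp add: divide_le_eq mult.commute del: of_nat_Suc)
      then have "k \<le> Suc n"
        unfolding k_def by (metis ceiling_le_iff nat_le_iff of_int_of_nat_eq)
      then have "real k * t / real (Suc n) \<in> set (grid t n)"
        unfolding grid_def by (auto simp del: upt_Suc of_nat_Suc)
      moreover have "p \<le> real k * t / real (Suc n)"
        using k(1) pos(1) by (simp add: field_simps del: of_nat_Suc)
      moreover have "real k * t / real (Suc n) < p + t / real (Suc n)"
        using k(2) pos(1) by (simp add: field_simps del: of_nat_Suc)
      ultimately show ?case using elim by (intro impI bexI[of _ "real k * t / real (Suc n)"]) force+
    qed
  qed
qed

lemma coalesce_eq_driver_eventually:
  assumes A: "finite A" "a \<in> A" and w: "\<And>b. b \<in> A \<Longrightarrow> w b \<in> skip_free_paths T"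
    and t: "0 \<le> t" "t \<le> T"
  shows "\<forall>\<^sub>F n in sequentially. coalesce A w a t = w (driver A w (grid t n) a) t"
proof -
  have "\<forall>b\<in>A. \<exists>P. finite P \<and> step_on P T (w b)"
    using skip_free_path_step_on w t by auto
  then obtain P where P: "\<And>b. b \<in> A \<Longrightarrow> finite (P b) \<and> step_on (P b) T (w b)" by metis
  define Q where "Q = insert 0 (\<Union>b\<in>A. P b)"
  have Q: "finite Q" "0 \<in> Q" using A P by (auto simp: Q_def)
  have step: "step_on Q t (w b)" if "b \<in> A" for b
    using P[OF that] t(2) that by (elim conjE step_on_mono) (auto simp: Q_def)
  from grid_fine[OF Q(1) t(1)] show ?thesis
  proof eventually_elim
    case (elim n)
    have "coalesce_list (sorted_list_of_set A) w a t =
        w (driver (set (sorted_list_of_set A)) w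
             (map (\<lambda>k. real k * t / real (Suc n)) [0..<Suc n] @ [t]) a) t"
      by (rule coalesce_list_eq_driver[OF Q sorted_grid[OF t(1), of n] set_grid[OF t(1), of n], where ?ts2.0 = "[]"])
         (use elim A step in \<open>auto simp: grid_snoc simp del: upt_Suc of_nat_Suc\<close>)
    with A show ?case by (simp add: coalesce_def grid_snoc del: upt_Suc of_nat_Suc)
  qed
qed

section \<open>Integrals of determinants over product measures\<close>

lemma has_sum_measure_values:
  fixes X :: "'a \<Rightarrow> 'c::countable"
  assumes "finite_measure N" and X: "X \<in> measurable N (count_space UNIV)" and B: "B \<in> sets N"
  shows "((\<lambda>z. measure N {w \<in> B. X w = z}) has_sum measure N {w \<in> B. X w \<in> S}) S"
proof -
  interpret finite_measure N by fact
  have [measurable]: "X \<in> measurable N (count_space UNIV)" "B \<in> sets N" by fact+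
  let ?F = "\<lambda>i. {w \<in> B. X w \<in> S \<and> to_nat (X w) = i}"
  have meas: "{w \<in> B. P (X w)} \<in> sets N" for P
  proof -
    have "{w \<in> B. P (X w)} = B \<inter> {w \<in> space N. P (X w)}"
      using sets.sets_into_space[OF B] by auto
    also have "\<dots> \<in> sets N" by measurable
    finally show ?thesis .
  qed
  have "(\<lambda>i. measure N (?F i)) sums measure N (\<Union>i. ?F i)"
    using meas[of "\<lambda>v. v \<in> S \<and> to_nat v = _"]
    by (intro finite_measure_UNION) (auto simp: disjoint_family_on_def)
  moreover have "(\<Union>i. ?F i) = {w \<in> B. X w \<in> S}" by auto
  ultimately have "((\<lambda>i. measure N (?F i)) has_sum measure N {w \<in> B. X w \<in> S}) UNIV"
    by (intro sums_nonneg_imp_has_sum) auto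
  moreover have "measure N (?F i) = 0" if "i \<notin> to_nat ` S" for i
  proof -
    have "?F i = {}" using that by auto
    then show ?thesis by (metis measure_empty)
  qed
  ultimately have "((\<lambda>i. measure N (?F i)) has_sum measure N {w \<in> B. X w \<in> S}) (to_nat ` S)"
    by (subst has_sum_cong_neutral[of UNIV "to_nat ` S"]) auto
  then have "((\<lambda>i. measure N (?F i)) \<circ> to_nat has_sum measure N {w \<in> B. X w \<in> S}) S"
    by (subst has_sum_reindex[symmetric]) auto
  then show ?thesis
    by (rule has_sum_cong[THEN iffD1, rotated]) (auto intro!: arg_cong[where f = "measure N"])
qed

text \<open>
  Conditioning on a discrete random variable \<open>G\<close>, with the elementary conditional expectations on
  the events \<open>G = G w0\<close> in place of a conditional measure.
\<close>

lemma integral_eq_by_countable_cases: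
  fixes f g :: "'a \<Rightarrow> real" and G :: "'a \<Rightarrow> 'c::countable"
  assumes f: "integrable M f" and g: "integrable M g"
    and G: "G \<in> measurable M (count_space UNIV)"
    and eq: "\<And>w0. w0 \<in> space M \<Longrightarrow>
      (\<integral>w. indicator {w \<in> space M. G w = G w0} w * f w \<partial>M) =
      (\<integral>w. indicator {w \<in> space M. G w = G w0} w * g w \<partial>M)"
  shows "integral\<^sup>L M f = integral\<^sup>L M g"
proof -
  have [measurable]: "G \<in> measurable M (count_space UNIV)" by fact
  let ?A = "\<lambda>i. {w \<in> space M. to_nat (G w) = i}"
  have sum: "(LINT w:space M|M. h w) = (\<Sum>i. LINT w:?A i|M. h w)" if "integrable M h" for h :: "'a \<Rightarrow> real"
  proof -
    have "(LINT w:(\<Union>i. ?A i)|M. h w) = (\<Sum>i. LINT w:?A i|M. h w)"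
    proof (rule lebesgue_integral_countable_add)
      show "set_integrable M (\<Union>i. ?A i) h"
        unfolding set_integrable_def using that by (intro integrable_mult_indicator) measurable
    qed (measurable, auto)
    moreover have "(\<Union>i. ?A i) = space M" by auto
    ultimately show ?thesis by simp
  qed
  have "(LINT w:?A i|M. f w) = (LINT w:?A i|M. g w)" for i
  proof (cases "?A i = {}")
    case False
    then obtain w0 where "w0 \<in> space M" "?A i = {w \<in> space M. G w = G w0}" by force
    then show ?thesis using eq[of w0] by (simp add: set_lebesgue_integral_def)
  qed (simp add: set_lebesgue_integral_def)
  then have "(LINT w:space M|M. f w) = (LINT w:space M|M. g w)"
    by (simp add: sum[OF f] sum[OF g])
  then show ?thesis by (simp add: set_integral_space f g)
qed

lemma measurable_row_det:
  assumes "\<And>i j. i < n \<Longrightarrow> j < n \<Longrightarrow> (\<lambda>w. R w i j) \<in> borel_measurable M"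
  shows "(\<lambda>w. row_det n (R w)) \<in> borel_measurable M"
  unfolding row_det_expand
proof (intro borel_measurable_sum borel_measurable_times borel_measurable_prod borel_measurable_const)
  fix p i assume "p \<in> {p. p permutes {0..<n}}" "i \<in> {0..<n}"
  then show "(\<lambda>w. R w i (p i)) \<in> borel_measurable M"
    by (intro assms) (auto simp: permutes_lt)
qed

lemma measurable_count_space_borel:
  "f \<in> measurable M (count_space UNIV) \<Longrightarrow> f \<in> borel_measurable M"
  by (rule measurable_compose[of f M "count_space UNIV" "\<lambda>x. x"]) auto

lemma measurable_row_det_of_bool:
  assumes "\<And>i. i < n \<Longrightarrow> X i \<in> measurable M (count_space UNIV)"
  shows "(\<lambda>w. row_det n (\<lambda>i j. of_bool (X i w \<in> S j) - \<epsilon> i j)) \<in> borel_measurable M"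
proof (intro measurable_row_det borel_measurable_diff borel_measurable_const)
  fix i j assume "i < n"
  show "(\<lambda>w. of_bool (X i w \<in> S j) :: real) \<in> borel_measurable M"
    by (rule measurable_compose[OF assms[OF \<open>i < n\<close>], where g = "\<lambda>z. of_bool (z \<in> S j)"]) simp
qed

lemma integrable_bounded_row_det:
  assumes "prob_space M"
    and "(\<lambda>w. row_det n (\<lambda>i j. of_bool (Q w i j) - \<epsilon> i j)) \<in> borel_measurable M"
  shows "integrable M (\<lambda>w. row_det n (\<lambda>i j. of_bool (Q w i j) - \<epsilon> i j))"
proof -
  interpret prob_space M by fact
  have "\<bar>row_det n (\<lambda>i j. of_bool (Q w i j) - \<epsilon> i j)\<bar> \<le>
      (\<Sum>p | p permutes {0..<n}. \<Prod>i = 0..<n. 1 + \<bar>\<epsilon> i (p i)\<bar>)" for w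
    by (rule row_det_bounded) auto
  then show ?thesis
    by (intro integrable_const_bound[OF _ assms(2)] AE_I2) simp
qed

text \<open>
  Independent expectations may be taken inside the determinant even if several rows share a
  coordinate \<open>\<rho> i\<close>: the coordinates are integrated one at a time, and the determinant is affine in
  the vector of each of them. The events \<open>B a\<close> will describe the past, and \<open>m a\<close> is the conditional
  expectation of the vector given \<open>B a\<close>. The values \<open>U\<close> stand for coordinates that have been
  replaced by their expectations already.
\<close>

lemma integral_PiM_row_det:
  fixes N :: "int \<Rightarrow> 'b measure"
  assumes prob: "\<And>a. prob_space (N a)" and "finite A"
    and B: "\<And>a. a \<in> A \<Longrightarrow> B a \<in> sets (N a)"
    and V: "\<And>a j. a \<in> A \<Longrightarrow> V a j \<in> sets (N a)"
    and m: "\<And>a j. a \<in> A \<Longrightarrow> measure (N a) (B a \<inter> V a j) = measure (N a) (B a) * m a j"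
  shows "(\<integral>w. (\<Prod>a\<in>A. indicator (B a) (w a)) *
            row_det n (\<lambda>i j. (if \<rho> i \<in> A then indicator (V (\<rho> i) j) (w (\<rho> i)) else U (\<rho> i) j) - \<epsilon> i j)
           \<partial>Pi\<^sub>M A N) =
         (\<Prod>a\<in>A. measure (N a) (B a)) *
           row_det n (\<lambda>i j. (if \<rho> i \<in> A then m (\<rho> i) j else U (\<rho> i) j) - \<epsilon> i j)"
  using assms(2-)
proof (induction A arbitrary: U rule: finite_induct)
  case empty
  interpret P: prob_space "Pi\<^sub>M {} N" using prob by (intro prob_space_PiM)
  show ?case by (simp add: P.prob_space)
next
  case (insert a A)
  interpret product_sigma_finite N
    using prob by (simp add: product_sigma_finite_def prob_space_imp_sigma_finite)
  interpret Na: prob_space "N a" by (rule prob)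
  interpret P: prob_space "Pi\<^sub>M (insert a A) N" using prob by (intro prob_space_PiM)
  have [measurable]: "B b \<in> sets (N b)" "V b j \<in> sets (N b)" if "b \<in> insert a A" for b j
    using insert.prems that by auto
  let ?f = "\<lambda>w. (\<Prod>b\<in>insert a A. indicator (B b) (w b)) *
    row_det n (\<lambda>i j. (if \<rho> i \<in> insert a A then indicator (V (\<rho> i) j) (w (\<rho> i)) else U (\<rho> i) j) - \<epsilon> i j)
      :: real"
  let ?W = "\<lambda>w b j. if b \<in> A then indicator (V b j) (w b) else U b j :: real"
  have ind: "integrable (N a) (indicat_real C)" "(\<integral>y. indicat_real C y \<partial>N a) = measure (N a) C"
    if "C \<in> sets (N a)" for C
    using that sets.sets_into_space[OF that]
    by (auto simp: Int_absorb2 less_top[symmetric] intro!: integrable_real_indicator)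
  have BV: "B a \<in> sets (N a)" "B a \<inter> V a j \<in> sets (N a)" for j
    using insert.prems by auto
  have int_f: "integrable (Pi\<^sub>M (insert a A) N) ?f"
  proof (rule P.integrable_const_bound)
    let ?K = "\<lambda>i j. 1 + \<bar>U (\<rho> i) j\<bar> + \<bar>\<epsilon> i j\<bar>"
    let ?b = "\<Sum>p | p permutes {0..<n}. \<Prod>i = 0..<n. ?K i (p i)"
    have "norm (?f w) \<le> 1 * ?b" for w
      unfolding abs_mult real_norm_def
    proof (rule mult_mono)
      show "\<bar>\<Prod>b\<in>insert a A. indicator (B b) (w b)\<bar> \<le> (1::real)"
        by (auto simp: abs_prod intro!: prod_le_1 simp: indicator_def)
      show "\<bar>row_det n (\<lambda>i j. (if \<rho> i \<in> insert a A then indicator (V (\<rho> i) j) (w (\<rho> i)) else U (\<rho> i) j) - \<epsilon> i j)\<bar> \<le> ?b"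
        by (rule row_det_bounded) (auto simp: indicator_def)
    qed auto
    then show "AE w in Pi\<^sub>M (insert a A) N. norm (?f w) \<le> 1 * ?b" by auto
    have comp: "(\<lambda>w. indicator C (w b) :: real) \<in> borel_measurable (Pi\<^sub>M (insert a A) N)"
      if "b \<in> insert a A" "C \<in> sets (N b)" for b C
      using that by (intro measurable_compose[OF measurable_component_singleton[OF that(1)]] borel_measurable_indicator)
    have entry: "(\<lambda>w. if \<rho> i \<in> insert a A then indicator (V (\<rho> i) j) (w (\<rho> i)) else U (\<rho> i) j)
        \<in> borel_measurable (Pi\<^sub>M (insert a A) N)" for i j
    proof (cases "\<rho> i \<in> insert a A")
      case True
      then show ?thesis using comp[OF True insert.prems(2)[OF True]] by (simp only: if_True)
    next
      case False
      then show ?thesis by (simp only: if_False borel_measurable_const)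
    qed
    show "?f \<in> borel_measurable (Pi\<^sub>M (insert a A) N)"
      by (intro borel_measurable_times borel_measurable_prod measurable_row_det
            borel_measurable_diff borel_measurable_const comp insert.prems(1) entry)
  qed
  have inner: "(\<integral>y. ?f (w(a := y)) \<partial>N a) =
      measure (N a) (B a) * ((\<Prod>b\<in>A. indicator (B b) (w b)) *
        row_det n (\<lambda>i j. (if \<rho> i \<in> A then indicator (V (\<rho> i) j) (w (\<rho> i)) else (U(a := m a)) (\<rho> i) j) - \<epsilon> i j))"
    for w
  proof -
    obtain \<alpha> \<beta> where aff:
      "row_det n (\<lambda>i j. ((?W w)(a := u)) (\<rho> i) j - \<epsilon> i j) = \<alpha> + (\<Sum>j<n. \<beta> j * u j)" for u
      using row_det_affine_in_label[of n "?W w" a \<rho> \<epsilon>] by auto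
    let ?c = "\<Prod>b\<in>A. indicator (B b) (w b) :: real"
    have prod: "(\<Prod>b\<in>A. indicator (B b) ((w(a := y)) b)) = ?c" for y
      using insert.hyps by (intro prod.cong) auto
    have "?f (w(a := y)) = ?c * (indicator (B a) y *
        row_det n (\<lambda>i j. ((?W w)(a := \<lambda>j. indicator (V a j) y)) (\<rho> i) j - \<epsilon> i j))" for y
    proof -
      have "row_det n (\<lambda>i j. (if \<rho> i \<in> insert a A then indicator (V (\<rho> i) j) ((w(a := y)) (\<rho> i))
              else U (\<rho> i) j) - \<epsilon> i j) =
          row_det n (\<lambda>i j. ((?W w)(a := \<lambda>j. indicator (V a j) y)) (\<rho> i) j - \<epsilon> i j)"
        using insert.hyps by (intro row_det_cong) auto
      moreover have "(\<Prod>b\<in>insert a A. indicator (B b) ((w(a := y)) b)) = indicator (B a) y * ?c"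
        using insert.hyps prod by (subst prod.insert) auto
      ultimately show ?thesis by (simp only: mult_ac)
    qed
    also have "\<dots> y = ?c * (\<alpha> * indicator (B a) y + (\<Sum>j<n. \<beta> j * indicator (B a \<inter> V a j) y))" for y
      unfolding aff by (simp only: distrib_left sum_distrib_left indicator_inter_arith mult_ac)
    finally have "(\<integral>y. ?f (w(a := y)) \<partial>N a) =
        ?c * (\<integral>y. \<alpha> * indicator (B a) y + (\<Sum>j<n. \<beta> j * indicator (B a \<inter> V a j) y) \<partial>N a)"
      by simp
    also have "(\<integral>y. \<alpha> * indicator (B a) y + (\<Sum>j<n. \<beta> j * indicator (B a \<inter> V a j) y) \<partial>N a) =
        \<alpha> * measure (N a) (B a) + (\<Sum>j<n. \<beta> j * measure (N a) (B a \<inter> V a j))"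
      using ind BV by (subst Bochner_Integration.integral_add)
        (simp_all only: Bochner_Integration.integral_sum integrable_mult_right
          Bochner_Integration.integrable_sum integral_mult_right_zero)
    also have "\<dots> = measure (N a) (B a) * (\<alpha> + (\<Sum>j<n. \<beta> j * m a j))"
      using insert.prems(3)[of a] by (simp add: algebra_simps sum_distrib_left)
    also have "\<alpha> + (\<Sum>j<n. \<beta> j * m a j) =
        row_det n (\<lambda>i j. (if \<rho> i \<in> A then indicator (V (\<rho> i) j) (w (\<rho> i)) else (U(a := m a)) (\<rho> i) j) - \<epsilon> i j)"
      unfolding aff[symmetric] using insert.hyps by (intro row_det_cong) auto
    finally show ?thesis by (simp add: mult_ac)
  qed
  have "integral\<^sup>L (Pi\<^sub>M (insert a A) N) ?f = (\<integral>w. (\<integral>y. ?f (w(a := y)) \<partial>N a) \<partial>Pi\<^sub>M A N)"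
    using insert.hyps int_f by (rule product_integral_insert)
  also have "\<dots> = measure (N a) (B a) * ((\<Prod>b\<in>A. measure (N b) (B b)) *
      row_det n (\<lambda>i j. (if \<rho> i \<in> A then m (\<rho> i) j else (U(a := m a)) (\<rho> i) j) - \<epsilon> i j))"
    unfolding inner using insert.IH[of "U(a := m a)"] insert.prems by simp
  also have "row_det n (\<lambda>i j. (if \<rho> i \<in> A then m (\<rho> i) j else (U(a := m a)) (\<rho> i) j) - \<epsilon> i j) =
      row_det n (\<lambda>i j. (if \<rho> i \<in> insert a A then m (\<rho> i) j else U (\<rho> i) j) - \<epsilon> i j)"
    using insert.hyps by (intro row_det_cong) auto
  finally show ?case using insert.hyps by (simp add: mult_ac)
qed

section \<open>The determinantal identity for the coalescing system\<close>

locale skip_free =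
  fixes T :: real and Pr :: "real \<Rightarrow> int \<Rightarrow> (real \<Rightarrow> int) measure"
  assumes T_pos: "0 < T" and process: "skip_free_process T Pr"
begin

lemma prob_space_Pr: "0 \<le> s \<Longrightarrow> s \<le> T \<Longrightarrow> prob_space (Pr s x)"
  and sets_Pr: "0 \<le> s \<Longrightarrow> s \<le> T \<Longrightarrow> sets (Pr s x) = sets (path_space T)"
  using process unfolding skip_free_process_def by auto

lemma space_Pr: "0 \<le> s \<Longrightarrow> s \<le> T \<Longrightarrow> w \<in> space (Pr s x) \<Longrightarrow> w \<in> skip_free_paths T"
  using sets_eq_imp_space_eq[OF sets_Pr[of s x]] by (auto simp: path_space_def space_restrict_space)

lemma prob_space_Pr_0: "prob_space (Pr 0 x)"
  using T_pos by (intro prob_space_Pr) auto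

lemma measurable_eval:
  assumes "0 \<le> s" "s \<le> T" "r \<in> {0..T}"
  shows "(\<lambda>w. w r) \<in> measurable (Pr s x) (count_space UNIV)"
  unfolding measurable_cong_sets[OF sets_Pr[OF assms(1,2)] refl] path_space_def
  by (intro measurable_restrict_space1 measurable_component_singleton assms)

lemma sets_cylinder:
  assumes "0 \<le> s" "s \<le> T" "finite I" "I \<subseteq> {0..T}"
  shows "{w \<in> space (Pr s x). \<forall>r\<in>I. w r = c r} \<in> sets (Pr s x)"
proof (rule sets.sets_Collect_finite_All[OF _ assms(3)])
  fix r assume "r \<in> I"
  then have "(\<lambda>w. w r) \<in> measurable (Pr s x) (count_space UNIV)"
    using assms by (intro measurable_eval) auto
  from measurable_sets[OF this, of "{c r}"]
  show "{w \<in> space (Pr s x). w r = c r} \<in> sets (Pr s x)"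
    by (simp add: vimage_def Int_def conj_commute)
qed

text \<open>
  The Markov property of the process is assumed for single target sites; countable
  additivity extends it to sets of sites. As \<open>d \<in> I\<close>, the present state \<open>c d\<close> is prescribed.
\<close>

lemma markov:
  assumes d: "0 \<le> d" "d \<le> T" "d \<in> I" and I: "finite I" "I \<subseteq> {0..d}"
  shows "measure (Pr 0 x) ({w \<in> space (Pr 0 x). \<forall>r\<in>I. w r = c r} \<inter> {w \<in> space (Pr 0 x). w T \<in> S}) =
         measure (Pr 0 x) {w \<in> space (Pr 0 x). \<forall>r\<in>I. w r = c r} *
         measure (Pr d (c d)) {w \<in> space (Pr d (c d)). w T \<in> S}"
proof -
  let ?B = "{w \<in> space (Pr 0 x). \<forall>r\<in>I. w r = c r}"
  interpret P: prob_space "Pr 0 x" by (rule prob_space_Pr_0)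
  interpret Q: prob_space "Pr d (c d)" using d by (intro prob_space_Pr)
  have T: "T \<in> {0..T}" using T_pos by simp
  have "?B \<in> sets (Pr 0 x)" using I d T_pos by (intro sets_cylinder) auto
  then have 1: "((\<lambda>z. measure (Pr 0 x) {w \<in> ?B. w T = z}) has_sum
      measure (Pr 0 x) {w \<in> ?B. w T \<in> S}) S"
    using T_pos T by (intro has_sum_measure_values P.finite_measure_axioms measurable_eval) auto
  have "((\<lambda>z. measure (Pr d (c d)) {w \<in> space (Pr d (c d)). w T = z}) has_sum
      measure (Pr d (c d)) {w \<in> space (Pr d (c d)). w T \<in> S}) S"
    using d T by (intro has_sum_measure_values Q.finite_measure_axioms measurable_eval) auto
  then have 2: "((\<lambda>z. measure (Pr 0 x) ?B * trans_prob Pr d T (c d) z) has_sum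
      measure (Pr 0 x) ?B * measure (Pr d (c d)) {w \<in> space (Pr d (c d)). w T \<in> S}) S"
    unfolding trans_prob_def by (rule has_sum_cmult_right)
  have step: "measure (Pr 0 x) {w \<in> ?B. w T = z} = measure (Pr 0 x) ?B * trans_prob Pr d T (c d) z" for z
  proof -
    have "\<forall>s t u x y z I c.
        0 \<le> s \<and> s \<le> t \<and> t \<le> u \<and> u \<le> T \<and> finite I \<and> I \<subseteq> {s..t} \<longrightarrow>
        measure (Pr s x) {w \<in> space (Pr s x). (\<forall>r\<in>I. w r = c r) \<and> w t = y \<and> w u = z} =
        measure (Pr s x) {w \<in> space (Pr s x). (\<forall>r\<in>I. w r = c r) \<and> w t = y} *
          trans_prob Pr t u y z"
      using process unfolding skip_free_process_def by (elim conjE)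
    from this[rule_format, of 0 d T I x c "c d" z]
    have "measure (Pr 0 x) {w \<in> space (Pr 0 x). (\<forall>r\<in>I. w r = c r) \<and> w d = c d \<and> w T = z} =
        measure (Pr 0 x) {w \<in> space (Pr 0 x). (\<forall>r\<in>I. w r = c r) \<and> w d = c d} * trans_prob Pr d T (c d) z"
      using d I by simp
    moreover have "{w \<in> space (Pr 0 x). (\<forall>r\<in>I. w r = c r) \<and> w d = c d \<and> w T = z} = {w \<in> ?B. w T = z}"
      "{w \<in> space (Pr 0 x). (\<forall>r\<in>I. w r = c r) \<and> w d = c d} = ?B"
      using d(3) by auto
    ultimately show ?thesis by simp
  qed
  have "{w \<in> ?B. w T \<in> S} = ?B \<inter> {w \<in> space (Pr 0 x). w T \<in> S}" by auto
  then show ?thesis using has_sum_unique[OF 1] 2 unfolding step by simp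
qed

definition driving_law :: "int set \<Rightarrow> (int \<Rightarrow> real \<Rightarrow> int) measure" where
  "driving_law A = Pi\<^sub>M A (Pr 0)"

lemma prob_space_driving_law: "prob_space (driving_law A)"
  unfolding driving_law_def by (intro prob_space_PiM prob_space_Pr_0)

lemma space_driving_law: "w \<in> space (driving_law A) \<Longrightarrow> a \<in> A \<Longrightarrow> w a \<in> space (Pr 0 a)"
  unfolding driving_law_def space_PiM by auto

lemma measurable_position:
  assumes "a \<in> A" "r \<in> {0..T}"
  shows "(\<lambda>w. w a r) \<in> measurable (driving_law A) (count_space UNIV)"
  using assms T_pos unfolding driving_law_def
  by (intro measurable_compose[where f = "\<lambda>w. w a" and g = "\<lambda>v. v r" and N = "Pr 0 a"]
        measurable_component_singleton measurable_eval) auto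

text \<open>
  The positions at finitely many times as an element of a countable type, so that \<open>positions\<close> can
  serve as the discrete variable on which one conditions.
\<close>

definition positions :: "int set \<Rightarrow> real list \<Rightarrow> (int \<Rightarrow> real \<Rightarrow> int) \<Rightarrow> int list list" where
  "positions A ts w = map (\<lambda>a. map (w a) ts) (sorted_list_of_set A)"

lemma positions_eq_iff:
  "finite A \<Longrightarrow> positions A ts w = positions A ts w' \<longleftrightarrow> (\<forall>a\<in>A. \<forall>t\<in>set ts. w a t = w' a t)"
  unfolding positions_def by auto

lemma measurable_positions:
  assumes "finite A" "set ts \<subseteq> {0..T}"
  shows "positions A ts \<in> measurable (driving_law A) (count_space UNIV)"
  unfolding measurable_count_space_eq2_countable
proof (intro conjI ballI)
  fix c
  show "positions A ts -` {c} \<inter> space (driving_law A) \<in> sets (driving_law A)"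
  proof (cases "\<exists>w0. positions A ts w0 = c")
    case True
    then obtain w0 where w0: "positions A ts w0 = c" by blast
    have "positions A ts -` {c} \<inter> space (driving_law A) =
        {w \<in> space (driving_law A). \<forall>a\<in>A. \<forall>t\<in>set ts. w a t = w0 a t}"
      using positions_eq_iff[OF assms(1), of ts _ w0] w0 by auto
    also have "\<dots> \<in> sets (driving_law A)"
    proof (intro sets.sets_Collect_finite_All assms(1) finite_set)
      fix a t assume "a \<in> A" "t \<in> set ts"
      then have "(\<lambda>w. w a t) \<in> measurable (driving_law A) (count_space UNIV)"
        using assms by (intro measurable_position) auto
      from measurable_sets[OF this, of "{w0 a t}"]
      show "{w \<in> space (driving_law A). w a t = w0 a t} \<in> sets (driving_law A)"
        by (simp add: vimage_def Int_def conj_commute)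
    qed
    finally show ?thesis .
  next
    case False
    then have "positions A ts -` {c} \<inter> space (driving_law A) = {}" by auto
    then show ?thesis by simp
  qed
qed simp

text \<open>
  A function of finitely many integer positions factors through a countable space and needs no
  further argument for its measurability.
\<close>

lemma measurable_of_positions:
  assumes "finite A" "set ts \<subseteq> {0..T}"
    and dep: "\<And>w w'. (\<And>a t. a \<in> A \<Longrightarrow> t \<in> set ts \<Longrightarrow> w a t = w' a t) \<Longrightarrow> H w = H w'"
  shows "H \<in> measurable (driving_law A) (count_space UNIV)"
proof (rule measurableI)
  fix X
  have eq: "H w = H w'" if "positions A ts w = positions A ts w'" for w w'
    using that positions_eq_iff[OF assms(1), of ts w w'] by (intro dep) blast
  have "H -` X = positions A ts -` (positions A ts ` (H -` X))"
  proof (intro equalityI subsetI)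
    fix w assume "w \<in> positions A ts -` (positions A ts ` (H -` X))"
    then obtain w' where "H w' \<in> X" "positions A ts w = positions A ts w'" by auto
    then show "w \<in> H -` X" using eq[of w w'] by simp
  qed auto
  then have "H -` X \<inter> space (driving_law A) = positions A ts -` (positions A ts ` (H -` X)) \<inter> space (driving_law A)"
    by (rule arg_cong)
  also have "\<dots> \<in> sets (driving_law A)"
    using measurable_positions[OF assms(1,2)] by (rule measurable_sets) simp
  finally show "H -` X \<inter> space (driving_law A) \<in> sets (driving_law A)" .
qed simp

text \<open>
  The step that allows mergers. \<open>R1\<close> and \<open>R2\<close> are two ways to assign driving paths to the rows,
  both determined by the past up to time \<open>d\<close>, and both give each row the same position at time \<open>d\<close>.
  Given the past, the expected determinant is a function of these positions alone, by
  \<open>integral_PiM_row_det\<close> and the Markov property.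
\<close>

lemma integral_row_det_drivers_eq:
  fixes R1 R2 :: "(int \<Rightarrow> real \<Rightarrow> int) \<Rightarrow> nat \<Rightarrow> int"
  assumes A: "finite A" and ts: "set ts \<subseteq> {0..d}" "d \<in> set ts" and d: "0 \<le> d" "d \<le> T"
    and dep: "\<forall>w w'. (\<forall>a\<in>A. \<forall>t\<in>set ts. w a t = w' a t) \<longrightarrow> (\<forall>i<n. R1 w i = R1 w' i)"
      "\<forall>w w'. (\<forall>a\<in>A. \<forall>t\<in>set ts. w a t = w' a t) \<longrightarrow> (\<forall>i<n. R2 w i = R2 w' i)"
    and in_A: "\<forall>w. \<forall>i<n. R1 w i \<in> A" "\<forall>w. \<forall>i<n. R2 w i \<in> A"
    and same: "\<And>w i. i < n \<Longrightarrow> w (R1 w i) d = w (R2 w i) d"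
  shows "(\<integral>w. row_det n (\<lambda>i j. of_bool (w (R1 w i) T \<in> S j) - \<epsilon> i j) \<partial>driving_law A) =
         (\<integral>w. row_det n (\<lambda>i j. of_bool (w (R2 w i) T \<in> S j) - \<epsilon> i j) \<partial>driving_law A)"
proof (rule integral_eq_by_countable_cases)
  have tsT: "set (T # ts) \<subseteq> {0..T}" using ts d T_pos by auto
  have int: "integrable (driving_law A) (\<lambda>w. row_det n (\<lambda>i j. of_bool (w (R w i) T \<in> S j) - \<epsilon> i j))"
    if dep: "\<forall>w w'. (\<forall>a\<in>A. \<forall>t\<in>set ts. w a t = w' a t) \<longrightarrow> (\<forall>i<n. R w i = R w' i)"
      and R: "\<forall>w. \<forall>i<n. R w i \<in> A" for R :: "(int \<Rightarrow> real \<Rightarrow> int) \<Rightarrow> nat \<Rightarrow> int"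
  proof (intro integrable_bounded_row_det prob_space_driving_law measurable_count_space_borel
      measurable_of_positions[OF A tsT] row_det_cong)
    fix w w' :: "int \<Rightarrow> real \<Rightarrow> int" and i j
    assume eq: "\<And>a t. a \<in> A \<Longrightarrow> t \<in> set (T # ts) \<Longrightarrow> w a t = w' a t" and i: "i < n"
    have "R w i = R w' i" using dep[rule_format, of w w' i] eq i by simp
    then show "of_bool (w (R w i) T \<in> S j) - \<epsilon> i j = of_bool (w' (R w' i) T \<in> S j) - \<epsilon> i j"
      using eq[of "R w i" T] R i by simp
  qed
  show "integrable (driving_law A) (\<lambda>w. row_det n (\<lambda>i j. of_bool (w (R1 w i) T \<in> S j) - \<epsilon> i j))"
    by (rule int[OF dep(1) in_A(1)])
  show "integrable (driving_law A) (\<lambda>w. row_det n (\<lambda>i j. of_bool (w (R2 w i) T \<in> S j) - \<epsilon> i j))"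
    by (rule int[OF dep(2) in_A(2)])
  show "positions A ts \<in> measurable (driving_law A) (count_space UNIV)"
    using tsT by (intro measurable_positions A) auto
  fix w0 assume w0: "w0 \<in> space (driving_law A)"
  let ?B = "\<lambda>a. {v \<in> space (Pr 0 a). \<forall>t\<in>set ts. v t = w0 a t}"
  let ?V = "\<lambda>a j. {v \<in> space (Pr 0 a). v T \<in> S j}"
  let ?m = "\<lambda>a j. measure (Pr d (w0 a d)) {v \<in> space (Pr d (w0 a d)). v T \<in> S j}"
  have ind: "indicator {w \<in> space (driving_law A). positions A ts w = positions A ts w0} w =
      (\<Prod>a\<in>A. indicator (?B a) (w a) :: real)" if "w \<in> space (driving_law A)" for w
  proof -
    have "(\<Prod>a\<in>A. indicator (?B a) (w a) :: real) = indicator (Pi A ?B) w"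
      using A by (auto simp: indicator_def Pi_def prod_zero_iff intro!: prod.neutral)
    then show ?thesis
      using that space_driving_law[OF that] positions_eq_iff[OF A, of ts w w0]
      by (auto simp: indicator_def Pi_def)
  qed
  have cond: "(\<integral>w. indicator {w \<in> space (driving_law A). positions A ts w = positions A ts w0} w *
        row_det n (\<lambda>i j. of_bool (w (R w i) T \<in> S j) - \<epsilon> i j) \<partial>driving_law A) =
      (\<Prod>a\<in>A. measure (Pr 0 a) (?B a)) * row_det n (\<lambda>i j. ?m (R w0 i) j - \<epsilon> i j)"
    if dep: "\<forall>w w'. (\<forall>a\<in>A. \<forall>t\<in>set ts. w a t = w' a t) \<longrightarrow> (\<forall>i<n. R w i = R w' i)"
      and R: "\<forall>w. \<forall>i<n. R w i \<in> A" for R :: "(int \<Rightarrow> real \<Rightarrow> int) \<Rightarrow> nat \<Rightarrow> int"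
  proof -
    have "(\<integral>w. indicator {w \<in> space (driving_law A). positions A ts w = positions A ts w0} w *
        row_det n (\<lambda>i j. of_bool (w (R w i) T \<in> S j) - \<epsilon> i j) \<partial>driving_law A) =
      (\<integral>w. (\<Prod>a\<in>A. indicator (?B a) (w a)) *
        row_det n (\<lambda>i j. (if R w0 i \<in> A then indicator (?V (R w0 i) j) (w (R w0 i)) else 0) - \<epsilon> i j) \<partial>driving_law A)"
    proof (rule Bochner_Integration.integral_cong[OF refl])
      fix w assume w: "w \<in> space (driving_law A)"
      show "indicator {w \<in> space (driving_law A). positions A ts w = positions A ts w0} w *
          row_det n (\<lambda>i j. of_bool (w (R w i) T \<in> S j) - \<epsilon> i j) =
        (\<Prod>a\<in>A. indicator (?B a) (w a)) *
          row_det n (\<lambda>i j. (if R w0 i \<in> A then indicator (?V (R w0 i) j) (w (R w0 i)) else 0) - \<epsilon> i j)"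
      proof (cases "positions A ts w = positions A ts w0")
        case True
        then have "R w i = R w0 i" if "i < n" for i
          using that positions_eq_iff[OF A, of ts w w0] dep[rule_format, of w w0 i] by simp
        then have "row_det n (\<lambda>i j. of_bool (w (R w i) T \<in> S j) - \<epsilon> i j) =
          row_det n (\<lambda>i j. (if R w0 i \<in> A then indicator (?V (R w0 i) j) (w (R w0 i)) else 0) - \<epsilon> i j)"
          using R space_driving_law[OF w] by (intro row_det_cong) (auto simp: indicator_def)
        then show ?thesis using ind[OF w] by simp
      next
        case False
        then show ?thesis using ind[OF w, symmetric] by simp
      qed
    qed
    also have "\<dots> = (\<Prod>a\<in>A. measure (Pr 0 a) (?B a)) *
        row_det n (\<lambda>i j. (if R w0 i \<in> A then ?m (R w0 i) j else 0) - \<epsilon> i j)"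
      unfolding driving_law_def
    proof (rule integral_PiM_row_det[OF prob_space_Pr_0 A])
      fix a j
      show "?B a \<in> sets (Pr 0 a)" using tsT T_pos by (intro sets_cylinder) auto
      have "(\<lambda>v. v T) \<in> measurable (Pr 0 a) (count_space UNIV)"
        using T_pos by (intro measurable_eval) auto
      from measurable_sets[OF this, of "S j"] show "?V a j \<in> sets (Pr 0 a)"
        by (simp add: vimage_def Int_def conj_commute)
      show "measure (Pr 0 a) (?B a \<inter> ?V a j) = measure (Pr 0 a) (?B a) * ?m a j"
        using d ts by (intro markov) auto
    qed
    also have "row_det n (\<lambda>i j. (if R w0 i \<in> A then ?m (R w0 i) j else 0) - \<epsilon> i j) =
        row_det n (\<lambda>i j. ?m (R w0 i) j - \<epsilon> i j)"
      using R by (intro row_det_cong) auto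
    finally show ?thesis .
  qed
  have "row_det n (\<lambda>i j. ?m (R1 w0 i) j - \<epsilon> i j) = row_det n (\<lambda>i j. ?m (R2 w0 i) j - \<epsilon> i j)"
    using same[of _ w0] by (intro row_det_cong) simp
  then show "(\<integral>w. indicator {w \<in> space (driving_law A). positions A ts w = positions A ts w0} w *
        row_det n (\<lambda>i j. of_bool (w (R1 w i) T \<in> S j) - \<epsilon> i j) \<partial>driving_law A) =
      (\<integral>w. indicator {w \<in> space (driving_law A). positions A ts w = positions A ts w0} w *
        row_det n (\<lambda>i j. of_bool (w (R2 w i) T \<in> S j) - \<epsilon> i j) \<partial>driving_law A)"
    by (simp only: cond[OF dep(1) in_A(1)] cond[OF dep(2) in_A(2)])
qed

text \<open>
  Deleting the last time at which mergers are allowed does not change the expectation, until none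
  is left and the paths are independent.
\<close>

lemma integral_row_det_skeleton:
  assumes A: "finite A" and s: "\<And>i. i < n \<Longrightarrow> s i \<in> A" and ts: "sorted ts" "set ts \<subseteq> {0..T}"
  shows "(\<integral>w. row_det n (\<lambda>i j. of_bool (w (driver A w ts (s i)) T \<in> S j) - \<epsilon> i j) \<partial>driving_law A) =
    row_det n (\<lambda>i j. measure (Pr 0 (s i)) {v \<in> space (Pr 0 (s i)). v T \<in> S j} - \<epsilon> i j)"
  using ts
proof (induction ts rule: rev_induct)
  case Nil
  let ?V = "\<lambda>a j. {v \<in> space (Pr 0 a). v T \<in> S j}"
  have V: "?V a j \<in> sets (Pr 0 a)" for a j
  proof -
    have "(\<lambda>v. v T) \<in> measurable (Pr 0 a) (count_space UNIV)"
      using T_pos by (intro measurable_eval) auto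
    from measurable_sets[OF this, of "S j"] show ?thesis
      by (simp add: vimage_def Int_def conj_commute)
  qed
  have "(\<integral>w. row_det n (\<lambda>i j. of_bool (w (driver A w [] (s i)) T \<in> S j) - \<epsilon> i j) \<partial>driving_law A) =
    (\<integral>w. (\<Prod>a\<in>A. indicator (space (Pr 0 a)) (w a)) *
       row_det n (\<lambda>i j. (if s i \<in> A then indicator (?V (s i) j) (w (s i)) else 0) - \<epsilon> i j) \<partial>driving_law A)"
  proof (rule Bochner_Integration.integral_cong[OF refl])
    fix w assume w: "w \<in> space (driving_law A)"
    have "(\<Prod>a\<in>A. indicator (space (Pr 0 a)) (w a)) = (1::real)"
      using space_driving_law[OF w] by (intro prod.neutral) auto
    moreover have "row_det n (\<lambda>i j. of_bool (w (driver A w [] (s i)) T \<in> S j) - \<epsilon> i j) =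
       row_det n (\<lambda>i j. (if s i \<in> A then indicator (?V (s i) j) (w (s i)) else 0) - \<epsilon> i j)"
      using s space_driving_law[OF w] by (intro row_det_cong) (auto simp: indicator_def)
    ultimately show "row_det n (\<lambda>i j. of_bool (w (driver A w [] (s i)) T \<in> S j) - \<epsilon> i j) =
      (\<Prod>a\<in>A. indicator (space (Pr 0 a)) (w a)) *
       row_det n (\<lambda>i j. (if s i \<in> A then indicator (?V (s i) j) (w (s i)) else 0) - \<epsilon> i j)"
      by simp
  qed
  also have "\<dots> = (\<Prod>a\<in>A. measure (Pr 0 a) (space (Pr 0 a))) *
      row_det n (\<lambda>i j. (if s i \<in> A then measure (Pr 0 (s i)) (?V (s i) j) else 0) - \<epsilon> i j)"
    unfolding driving_law_def
  proof (rule integral_PiM_row_det[OF prob_space_Pr_0 A])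
    fix a j
    show "measure (Pr 0 a) (space (Pr 0 a) \<inter> ?V a j) =
        measure (Pr 0 a) (space (Pr 0 a)) * measure (Pr 0 a) (?V a j)"
      using prob_space.prob_space[OF prob_space_Pr_0] sets.sets_into_space[OF V]
      by (simp add: Int_absorb1)
  qed (use V in auto)
  also have "(\<Prod>a\<in>A. measure (Pr 0 a) (space (Pr 0 a))) = 1"
    using prob_space.prob_space[OF prob_space_Pr_0] by simp
  also have "row_det n (\<lambda>i j. (if s i \<in> A then measure (Pr 0 (s i)) (?V (s i) j) else 0) - \<epsilon> i j) =
      row_det n (\<lambda>i j. measure (Pr 0 (s i)) (?V (s i) j) - \<epsilon> i j)"
    using s by (intro row_det_cong) auto
  finally show ?case by simp
next
  case (snoc d ts)
  have d: "0 \<le> d" "d \<le> T" "set ts \<subseteq> {0..d}"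
    using snoc.prems by (auto simp: sorted_append)
  have cong: "driver A w us a = driver A w' us a"
    if "\<forall>a\<in>A. \<forall>t\<in>set (ts @ [d]). w a t = w' a t" "set us \<subseteq> set (ts @ [d])" "a \<in> A" for w w' us a
    using that A by (intro driver_cong) auto
  have "(\<integral>w. row_det n (\<lambda>i j. of_bool (w (driver A w (ts @ [d]) (s i)) T \<in> S j) - \<epsilon> i j) \<partial>driving_law A) =
        (\<integral>w. row_det n (\<lambda>i j. of_bool (w (driver A w ts (s i)) T \<in> S j) - \<epsilon> i j) \<partial>driving_law A)"
  proof (rule integral_row_det_drivers_eq[OF A, where ts = "ts @ [d]" and d = d])
    show "\<forall>w w'. (\<forall>a\<in>A. \<forall>t\<in>set (ts @ [d]). w a t = w' a t) \<longrightarrow>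
        (\<forall>i<n. driver A w (ts @ [d]) (s i) = driver A w' (ts @ [d]) (s i))"
      using cong[of _ _ "ts @ [d]"] s by blast
    show "\<forall>w w'. (\<forall>a\<in>A. \<forall>t\<in>set (ts @ [d]). w a t = w' a t) \<longrightarrow>
        (\<forall>i<n. driver A w ts (s i) = driver A w' ts (s i))"
      using cong[of _ _ ts] s by (intro allI impI) auto
  qed (use d A s driver_in driver_snoc_position in auto)
  then show ?case using snoc by (simp add: sorted_append)
qed

lemma coalesce_eq_driver:
  assumes A: "finite A" "a \<in> A" and t: "0 \<le> t" "t \<le> T" and w: "w \<in> space (driving_law A)"
  shows "\<forall>\<^sub>F n in sequentially. coalesce A w a t = w (driver A w (grid t n) a) t"
proof (rule coalesce_eq_driver_eventually[OF A _ t])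
  fix b assume "b \<in> A"
  then show "w b \<in> skip_free_paths T"
    using space_Pr[of 0 "w b" b] space_driving_law[OF w] T_pos by auto
qed

lemma measurable_driver_position:
  assumes A: "finite A" "a \<in> A" and t: "0 \<le> t" "t \<le> T"
  shows "(\<lambda>w. w (driver A w (grid t n) a) t) \<in> measurable (driving_law A) (count_space UNIV)"
proof (rule measurable_of_positions[OF A(1)])
  show "set (grid t n) \<subseteq> {0..T}" using set_grid[OF t(1), of n] t by auto
  fix w w' :: "int \<Rightarrow> real \<Rightarrow> int" assume eq: "\<And>b u. b \<in> A \<Longrightarrow> u \<in> set (grid t n) \<Longrightarrow> w b u = w' b u"
  then have "driver A w (grid t n) a = driver A w' (grid t n) a" using A by (intro driver_cong)
  moreover have "t \<in> set (grid t n)" by (simp add: grid_snoc)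
  ultimately show "w (driver A w (grid t n) a) t = w' (driver A w' (grid t n) a) t"
    using eq driver_in[OF A] by simp
qed

text \<open>
  The definition of \<open>coalesce\<close> quantifies over uncountably many times, but its values are
  eventual values of the systems that merge on a grid.
\<close>

lemma measurable_coalesce:
  assumes A: "finite A" "a \<in> A" and t: "0 \<le> t" "t \<le> T"
  shows "(\<lambda>w. coalesce A w a t) \<in> measurable (driving_law A) (count_space UNIV)"
proof (rule measurableI)
  fix X
  have "coalesce A w a t \<in> X \<longleftrightarrow> (\<forall>\<^sub>F n in sequentially. w (driver A w (grid t n) a) t \<in> X)"
    if "w \<in> space (driving_law A)" for w
  proof -
    have ev: "\<forall>\<^sub>F n in sequentially. coalesce A w a t = w (driver A w (grid t n) a) t"
      using coalesce_eq_driver[OF A t that] .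
    have "(\<forall>\<^sub>F n in sequentially. w (driver A w (grid t n) a) t \<in> X) \<longleftrightarrow>
        (\<forall>\<^sub>F n in sequentially. coalesce A w a t \<in> X)"
      by (rule eventually_cong[OF ev]) simp
    then show ?thesis by simp
  qed
  then have "(\<lambda>w. coalesce A w a t) -` X \<inter> space (driving_law A) =
      {w \<in> space (driving_law A). \<forall>\<^sub>F n in sequentially. w (driver A w (grid t n) a) t \<in> X}"
    by auto
  also have "\<dots> \<in> sets (driving_law A)"
    unfolding eventually_sequentially
  proof (intro sets.sets_Collect_countable_Ex sets.sets_Collect_countable_All sets.sets_Collect_imp
      sets.sets_Collect_const)
    fix n
    from measurable_sets[OF measurable_driver_position[OF A t, of n], of X]
    show "{w \<in> space (driving_law A). w (driver A w (grid t n) a) t \<in> X} \<in> sets (driving_law A)"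
      by (simp add: vimage_def Int_def conj_commute)
  qed
  finally show "(\<lambda>w. coalesce A w a t) -` X \<inter> space (driving_law A) \<in> sets (driving_law A)" .
qed simp

lemma integral_row_det_coalesce:
  assumes A: "finite A" and s: "\<And>i. i < n \<Longrightarrow> s i \<in> A"
  shows "(\<integral>w. row_det n (\<lambda>i j. of_bool (coalesce A w (s i) T \<in> S j) - \<epsilon> i j) \<partial>driving_law A) =
    row_det n (\<lambda>i j. measure (Pr 0 (s i)) {v \<in> space (Pr 0 (s i)). v T \<in> S j} - \<epsilon> i j)"
    (is "?lhs = ?rhs")
proof -
  interpret prob_space "driving_law A" by (rule prob_space_driving_law)
  let ?f = "\<lambda>m w. row_det n (\<lambda>i j. of_bool (w (driver A w (grid T m) (s i)) T \<in> S j) - \<epsilon> i j)"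
  let ?g = "\<lambda>w. row_det n (\<lambda>i j. of_bool (coalesce A w (s i) T \<in> S j) - \<epsilon> i j)"
  have T: "0 \<le> T" "T \<le> T" using T_pos by auto
  have "(\<lambda>m. integral\<^sup>L (driving_law A) (?f m)) \<longlonglongrightarrow> integral\<^sup>L (driving_law A) ?g"
  proof (rule integral_dominated_convergence)
    show "?g \<in> borel_measurable (driving_law A)"
      by (rule measurable_row_det_of_bool) (use measurable_coalesce[OF A s T] in auto)
    show "?f m \<in> borel_measurable (driving_law A)" for m
      by (rule measurable_row_det_of_bool) (use measurable_driver_position[OF A s T] in auto)
    show "integrable (driving_law A) (\<lambda>w. \<Sum>p | p permutes {0..<n}. \<Prod>i = 0..<n. 1 + \<bar>\<epsilon> i (p i)\<bar>)"
      by simp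
    have "norm (?f m w) \<le> (\<Sum>p | p permutes {0..<n}. \<Prod>i = 0..<n. 1 + \<bar>\<epsilon> i (p i)\<bar>)" for m w
      unfolding real_norm_def by (rule row_det_bounded) auto
    then show "AE w in driving_law A. norm (?f m w) \<le> (\<Sum>p | p permutes {0..<n}. \<Prod>i = 0..<n. 1 + \<bar>\<epsilon> i (p i)\<bar>)" for m
      by simp
    show "AE w in driving_law A. (\<lambda>m. ?f m w) \<longlonglongrightarrow> ?g w"
    proof (rule AE_I2)
      fix w assume w: "w \<in> space (driving_law A)"
      have "\<forall>\<^sub>F m in sequentially. \<forall>i\<in>{..<n}. coalesce A w (s i) T = w (driver A w (grid T m) (s i)) T"
        using coalesce_eq_driver[OF A s T w] by (intro eventually_ball_finite) auto
      then have "\<forall>\<^sub>F m in sequentially. ?f m w = ?g w"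
        by eventually_elim (auto intro!: row_det_cong)
      then show "(\<lambda>m. ?f m w) \<longlonglongrightarrow> ?g w" by (rule tendsto_eventually)
    qed
  qed
  moreover have "integral\<^sup>L (driving_law A) (?f m) = ?rhs" for m
    using T by (intro integral_row_det_skeleton A s sorted_grid set_grid)
  ultimately show ?thesis using LIMSEQ_unique[OF _ tendsto_const] by simp
qed

text \<open>
  The Karlin--McGregor assumption, which concerns pairs of independent paths, is carried over to
  two coalescing particles: before they meet they are in order, afterwards they coincide.
\<close>

lemma AE_coalesce_pair_ordered:
  assumes "a < b"
  shows "AE w in driving_law {a, b}. coalesce {a, b} w a T \<le> coalesce {a, b} w b T"
proof -
  interpret prob_space "driving_law {a, b}" by (rule prob_space_driving_law)
  interpret product_prob_space "Pr 0"
    by (intro product_prob_spaceI prob_space_Pr_0)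
  let ?h = "\<lambda>w. (w a, w b)"
  have h [measurable]: "?h \<in> measurable (driving_law {a, b}) (Pr 0 a \<Otimes>\<^sub>M Pr 0 b)"
    unfolding driving_law_def by (intro measurable_Pair measurable_component_singleton) auto
  have eq: "Pr 0 a \<Otimes>\<^sub>M Pr 0 b = distr (driving_law {a, b}) (Pr 0 a \<Otimes>\<^sub>M Pr 0 b) ?h"
  proof (rule pair_measure_eqI)
    fix X Y assume XY: "X \<in> sets (Pr 0 a)" "Y \<in> sets (Pr 0 b)"
    have "emeasure (distr (driving_law {a, b}) (Pr 0 a \<Otimes>\<^sub>M Pr 0 b) ?h) (X \<times> Y) =
        emeasure (driving_law {a, b}) (Pi\<^sub>E {a, b} (\<lambda>c. if c = a then X else Y))"
      using XY h assms sets.sets_into_space[OF XY(1)] sets.sets_into_space[OF XY(2)]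
      by (subst emeasure_distr)
         (auto simp: driving_law_def space_PiM PiE_iff split: if_splits intro!: arg_cong[where f = "emeasure _"])
    also have "\<dots> = (\<Prod>c\<in>{a, b}. emeasure (Pr 0 c) (if c = a then X else Y))"
      unfolding driving_law_def using XY by (intro emeasure_PiM) auto
    also have "\<dots> = emeasure (Pr 0 a) X * emeasure (Pr 0 b) Y"
      using assms by simp
    finally show "emeasure (Pr 0 a) X * emeasure (Pr 0 b) Y =
        emeasure (distr (driving_law {a, b}) (Pr 0 a \<Otimes>\<^sub>M Pr 0 b) ?h) (X \<times> Y)" ..
  qed (auto intro!: prob_space_imp_sigma_finite prob_space_Pr_0)
  have order: "AE (w, w') in Pr 0 a \<Otimes>\<^sub>M Pr 0 b.
      \<forall>t\<in>{0..T}. (\<forall>u\<in>{0..t}. w u \<noteq> w' u) \<longrightarrow> w t < w' t"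
    using process assms unfolding skip_free_process_def by blast
  have "AE p in distr (driving_law {a, b}) (Pr 0 a \<Otimes>\<^sub>M Pr 0 b) ?h. case p of (w, w') \<Rightarrow>
      \<forall>t\<in>{0..T}. (\<forall>u\<in>{0..t}. w u \<noteq> w' u) \<longrightarrow> w t < w' t"
    using order by (subst eq[symmetric])
  from AE_distrD[OF h this]
  have "AE w in driving_law {a, b}. \<forall>t\<in>{0..T}. (\<forall>u\<in>{0..t}. w a u \<noteq> w b u) \<longrightarrow> w a t < w b t"
    by simp
  then show ?thesis
  proof (rule AE_mp, intro AE_I2 impI)
    fix w assume w: "w \<in> space (driving_law {a, b})"
      and order: "\<forall>t\<in>{0..T}. (\<forall>u\<in>{0..t}. w a u \<noteq> w b u) \<longrightarrow> w a t < w b t"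
    have T: "0 \<le> T" "T \<le> T" using T_pos by auto
    have lists: "sorted_list_of_set {a, b} = [a, b]" using assms by simp
    have alone: "merge_path {} v = v" for v by (rule ext) (simp add: merge_path_def)
    have b: "coalesce {a, b} w b = w b"
      using assms by (simp add: coalesce_def lists alone)
    have a: "coalesce {a, b} w a = merge_path {w b} (w a)"
      using assms by (simp add: coalesce_def lists alone)
    have "w a \<in> skip_free_paths T" "w b \<in> skip_free_paths T"
      using space_Pr[of 0] space_driving_law[OF w] T_pos by auto
    then obtain P Q where PQ: "finite P" "step_on P T (w a)" "finite Q" "step_on Q T (w b)"
      using skip_free_path_step_on T by metis
    define R where "R = insert 0 (P \<union> Q)"
    have R: "finite R" "0 \<in> R" using PQ by (auto simp: R_def)
    have st: "\<forall>g\<in>{w b}. step_on R T g" "step_on R T (w a)"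
      using step_on_mono[OF PQ(2), of R T] step_on_mono[OF PQ(4), of R T] by (auto simp: R_def)
    have co: "coalescing T {w b}" by (simp add: coalescing_def)
    from R st(1) co st(2) show "coalesce {a, b} w a T \<le> coalesce {a, b} w b T"
    proof (cases rule: merge_path_cases)
      case apart
      have "w a u \<noteq> w b u" if "u \<in> {0..T}" for u
        using apart(1)[of u "w b"] that by auto
      then have "w a T < w b T" using order T by simp
      then show ?thesis using apart(2)[OF T] a b by simp
    next
      case (meet u g)
      then show ?thesis using meet(8)[of T] a b by simp
    qed
  qed
qed

end

lemma coalescing_system_distr:
  fixes M :: "'a measure"
  assumes "skip_free T Pr" "coalescing_system T Pr M Z" and A: "finite A"
  defines "N \<equiv> Pi\<^sub>M ({0..T} \<times> A) (\<lambda>_. count_space UNIV) :: (real \<times> int \<Rightarrow> int) measure"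
  shows "(\<lambda>\<omega>. \<lambda>(t, x)\<in>{0..T} \<times> A. Z t x \<omega>) \<in> measurable M N"
    and "(\<lambda>w. \<lambda>(t, x)\<in>{0..T} \<times> A. coalesce A w x t) \<in> measurable (Pi\<^sub>M A (Pr 0)) N"
    and "distr M N (\<lambda>\<omega>. \<lambda>(t, x)\<in>{0..T} \<times> A. Z t x \<omega>) =
         distr (Pi\<^sub>M A (Pr 0)) N (\<lambda>w. \<lambda>(t, x)\<in>{0..T} \<times> A. coalesce A w x t)"
proof -
  interpret skip_free T Pr by fact
  show "(\<lambda>\<omega>. \<lambda>(t, x)\<in>{0..T} \<times> A. Z t x \<omega>) \<in> measurable M N"
    using assms(2) unfolding coalescing_system_def N_def by (intro measurable_restrict) auto
  show "(\<lambda>w. \<lambda>(t, x)\<in>{0..T} \<times> A. coalesce A w x t) \<in> measurable (Pi\<^sub>M A (Pr 0)) N"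
    unfolding N_def using measurable_coalesce[OF A] by (intro measurable_restrict) (auto simp: driving_law_def)
  show "distr M N (\<lambda>\<omega>. \<lambda>(t, x)\<in>{0..T} \<times> A. Z t x \<omega>) =
        distr (Pi\<^sub>M A (Pr 0)) N (\<lambda>w. \<lambda>(t, x)\<in>{0..T} \<times> A. coalesce A w x t)"
    using assms(2) A unfolding coalescing_system_def N_def by blast
qed

lemma coalescing_system_transfer:
  assumes "skip_free T Pr" "coalescing_system T Pr M Z" "finite A"
    and f: "f \<in> borel_measurable (Pi\<^sub>M ({0..T} \<times> A) (\<lambda>_. count_space UNIV))"
  shows "(\<integral>\<omega>. f (\<lambda>(t, x)\<in>{0..T} \<times> A. Z t x \<omega>) \<partial>M) =
         (\<integral>w. f (\<lambda>(t, x)\<in>{0..T} \<times> A. coalesce A w x t) \<partial>Pi\<^sub>M A (Pr 0) :: real)"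
  using integral_distr[OF coalescing_system_distr(1)[OF assms(1-3)] f]
    integral_distr[OF coalescing_system_distr(2)[OF assms(1-3)] f]
    coalescing_system_distr(3)[OF assms(1-3)]
  by simp

section \<open>Patterns as events on finitely many sites\<close>

lemma site_half_integer [simp]:
  "left_site (of_int n + 1/2) = n" "right_site (of_int n + 1/2) = n + 1"
  unfolding left_site_def right_site_def by (simp, linarith)

lemma walls_iff: "of_int n + 1/2 \<in> walls f \<longleftrightarrow> f n \<noteq> f (n + 1)"
proof -
  have "basin f (f n) = basin f (f (n + 1)) \<longleftrightarrow> f n = f (n + 1)"
    by (auto simp: basin_def)
  then show ?thesis by (auto simp: walls_def half_integers_def)
qed

lemma walls_half_integer: "h \<in> walls f \<Longrightarrow> \<exists>n. h = of_int n + 1/2"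
  by (auto simp: walls_def half_integers_def)

text \<open>
  With walls written as \<open>m l + 1/2\<close>, the pattern involves only countable quantifiers over sites.
  This form also yields the measurability of the event.
\<close>

lemma contains_pattern_iff_countable:
  assumes x: "\<forall>l\<in>{1..k}. x l = of_int (m l) + 1/2" and "k \<ge> 1"
  shows "contains_pattern f k x y \<longleftrightarrow>
     (\<forall>l\<in>{1..k}. f (m l) \<noteq> f (m l + 1)) \<and>
     (\<forall>n\<in>{m 1..m k}. n \<notin> m ` {1..k} \<longrightarrow> f n = f (n + 1)) \<and>
     (\<forall>l\<in>{0..k}. \<exists>n. f n = y l) \<and>
     (f (m 1) = y 0 \<and> (\<forall>n. f n = y 0 \<longrightarrow> n \<le> m 1)) \<and>
     (\<forall>l\<in>{1..<k}. \<forall>n. f n = y l \<longleftrightarrow> m l < n \<and> n \<le> m (l + 1)) \<and>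
     (f (m k + 1) = y k \<and> (\<forall>n. f n = y k \<longrightarrow> m k < n))"
proof -
  have lt: "of_int n < x l \<longleftrightarrow> n \<le> m l" "x l < of_int n \<longleftrightarrow> m l < n" if "l \<in> {1..k}" for n l
    using x[rule_format, OF that] by linarith+
  have 1: "(\<forall>l\<in>{1..k}. x l \<in> walls f) \<longleftrightarrow> (\<forall>l\<in>{1..k}. f (m l) \<noteq> f (m l + 1))"
    using x walls_iff[of _ f] by auto
  have 2: "walls f \<inter> {x 1..x k} \<subseteq> x ` {1..k} \<longleftrightarrow>
      (\<forall>n\<in>{m 1..m k}. n \<notin> m ` {1..k} \<longrightarrow> f n = f (n + 1))" (is "?L \<longleftrightarrow> ?R")
  proof
    assume L: ?L
    show ?R
    proof (intro ballI impI, rule ccontr)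
      fix n assume n: "n \<in> {m 1..m k}" "n \<notin> m ` {1..k}" "f n \<noteq> f (n + 1)"
      then have "of_int n + 1/2 \<in> walls f \<inter> {x 1..x k}"
        using x[rule_format, of 1] x[rule_format, of k] \<open>k \<ge> 1\<close> by (auto simp: walls_iff)
      with L obtain l where "l \<in> {1..k}" "of_int n + 1/2 = x l" by blast
      then show False using n(2) x[rule_format, of l] by auto
    qed
  next
    assume R: ?R
    show ?L
    proof
      fix h assume h: "h \<in> walls f \<inter> {x 1..x k}"
      then obtain n where n: "h = of_int n + 1/2" using walls_half_integer by blast
      then have "n \<in> {m 1..m k}" "f n \<noteq> f (n + 1)"
        using h x[rule_format, of 1] x[rule_format, of k] \<open>k \<ge> 1\<close> by (auto simp: walls_iff)
      then obtain l where l: "l \<in> {1..k}" "n = m l" using R by blast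
      then have "h = x l" using x n by simp
      then show "h \<in> x ` {1..k}" using l(1) by blast
    qed
  qed
  have 3: "(\<forall>l\<in>{1..<k}. basin f (y l) = {n. x l < of_int n \<and> of_int n < x (l + 1)}) \<longleftrightarrow>
      (\<forall>l\<in>{1..<k}. \<forall>n. f n = y l \<longleftrightarrow> m l < n \<and> n \<le> m (l + 1))"
    using lt by (auto simp: basin_def set_eq_iff)
  have 4: "left_site (x 1) = m 1" "right_site (x k) = m k + 1"
    using x[rule_format, of 1] x[rule_format, of k] \<open>k \<ge> 1\<close> by simp_all
  have 5: "(\<forall>n\<in>basin f (y 0). of_int n < x 1) \<longleftrightarrow> (\<forall>n. f n = y 0 \<longrightarrow> n \<le> m 1)"
    "(\<forall>n\<in>basin f (y k). x k < of_int n) \<longleftrightarrow> (\<forall>n. f n = y k \<longrightarrow> m k < n)"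
    using lt \<open>k \<ge> 1\<close> by (auto simp: basin_def)
  have 6: "(\<forall>l\<in>{0..k}. y l \<in> survivors f) \<longleftrightarrow> (\<forall>l\<in>{0..k}. \<exists>n. f n = y l)"
    by (auto simp: survivors_def image_iff eq_commute)
  show ?thesis
    unfolding contains_pattern_def 1 2 3 4 5 6 by (simp add: basin_def)
qed

lemma start_site_eq:
  assumes "\<forall>l\<in>{1..k}. x l = of_int (m l) + 1/2" "i < 2 * k"
  shows "start_site x (Suc i) = (if even i then m (Suc (i div 2)) else m (Suc (i div 2)) + 1)"
  using assms by (auto simp: start_site_def elim!: evenE oddE)

lemma left_sites_strict_mono:
  fixes x :: "nat \<Rightarrow> real"
  assumes x: "\<forall>l\<in>{1..k}. x l = of_int (m l) + 1/2" and "strict_mono_on {1..k} x"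
  shows "strict_mono_on {1..k} m"
proof (rule strict_mono_onI)
  fix l l' assume l: "l \<in> {1..k}" "l' \<in> {1..k}" "l < l'"
  then have "x l < x l'" using assms(2) by (auto simp: strict_mono_on_def)
  then show "m l < m l'" using x[rule_format, OF l(1)] x[rule_format, OF l(2)] by simp
qed

lemma start_site_mono:
  assumes x: "\<forall>l\<in>{1..k}. x l = of_int (m l) + 1/2" "strict_mono_on {1..k} x"
    and ij: "i \<le> j" "j < 2 * k"
  shows "start_site x (Suc i) \<le> start_site x (Suc j)"
proof (cases "i div 2 = j div 2")
  case True
  moreover have "i = j" if "even j" "odd i" using that True \<open>i \<le> j\<close> by presburger
  ultimately show ?thesis
    using start_site_eq[OF x(1), of i] start_site_eq[OF x(1), of j] ij by auto
next
  case False
  then have "i div 2 < j div 2" using ij by (simp add: div_le_mono order_less_le)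
  then have "m (Suc (i div 2)) < m (Suc (j div 2))"
    using ij by (intro strict_mono_onD[OF left_sites_strict_mono[OF x]]) auto
  then show ?thesis
    using start_site_eq[OF x(1), of i] start_site_eq[OF x(1), of j] ij by auto
qed

text \<open>
  Since \<open>f\<close> is monotone and takes the value \<open>y l\<close> at both ends of the stretch between consecutive
  walls, it is constant there; since \<open>y\<close> is strictly increasing, it does not take this value
  elsewhere.
\<close>

lemma contains_pattern_iff_endpoints:
  assumes x: "\<forall>l\<in>{1..k}. x l = of_int (m l) + 1/2" and k: "k \<ge> 1"
    and x_mono: "strict_mono_on {1..k} x" and y: "strict_mono_on {0..k} y" and f: "mono f"
  shows "contains_pattern f k x y \<longleftrightarrow> (\<forall>i<2 * k. f (start_site x (Suc i)) = y (Suc i div 2))"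
proof -
  have m_less: "m l < m l'" if "1 \<le> l" "l < l'" "l' \<le> k" for l l'
    using left_sites_strict_mono[OF x x_mono] that by (auto simp: strict_mono_on_def)
  have y_less: "y l < y l'" if "l < l'" "l' \<le> k" for l l'
    using y that by (auto simp: strict_mono_on_def)
  have f_le: "f a \<le> f b" if "a \<le> b" for a b using monoD[OF f that] .
  note start = start_site_eq[OF x]
  show ?thesis (is "_ \<longleftrightarrow> ?E")
  proof
    assume "contains_pattern f k x y"
    then have ends: "f (m 1) = y 0" "f (m k + 1) = y k"
      and mid: "\<And>l n. 1 \<le> l \<Longrightarrow> l < k \<Longrightarrow> m l < n \<Longrightarrow> n \<le> m (l + 1) \<Longrightarrow> f n = y l"
      unfolding contains_pattern_iff_countable[OF x k] by auto
    show ?E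
    proof (intro allI impI)
      fix i assume i: "i < 2 * k"
      show "f (start_site x (Suc i)) = y (Suc i div 2)"
      proof (cases "even i")
        case True
        then obtain l where l: "i = 2 * l" by (elim evenE)
        show ?thesis
        proof (cases "l = 0")
          case False
          then have "f (m (Suc l)) = y l"
            using mid[of l "m (Suc l)"] m_less[of l "Suc l"] i l by auto
          then show ?thesis using start[OF i] l by simp
        qed (use start[OF i] l ends in simp)
      next
        case False
        then obtain l where l: "i = 2 * l + 1" by (elim oddE)
        show ?thesis
        proof (cases "Suc l = k")
          case True
          then show ?thesis using start[OF i] l ends by simp
        next
          case False
          then have "f (m (Suc l) + 1) = y (Suc l)"
            using mid[of "Suc l" "m (Suc l) + 1"] m_less[of "Suc l" "Suc (Suc l)"] i l by auto
          then show ?thesis using start[OF i] l by simp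
        qed
      qed
    qed
  next
    assume E: ?E
    have left: "f (m l) = y (l - 1)" if "1 \<le> l" "l \<le> k" for l
      using E[rule_format, of "2 * (l - 1)"] start[of "2 * (l - 1)"] that by simp
    have right: "f (m l + 1) = y l" if "1 \<le> l" "l \<le> k" for l
    proof -
      have i: "2 * (l - 1) + 1 < 2 * k" "Suc (2 * (l - 1) + 1) div 2 = l" "Suc ((2 * (l - 1) + 1) div 2) = l"
        using that by auto
      show ?thesis using E[rule_format, OF i(1)] start[OF i(1)] i by simp
    qed
    have below: "f n \<le> y (l - 1)" if "1 \<le> l" "l \<le> k" "n \<le> m l" for n l
      using f_le[OF that(3)] left[of l] that by simp
    have above: "y l \<le> f n" if "1 \<le> l" "l \<le> k" "m l < n" for n l
      using f_le[of "m l + 1" n] right[of l] that by simp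
    have mid: "f n = y l \<longleftrightarrow> m l < n \<and> n \<le> m (l + 1)" if "l \<in> {1..<k}" for n l
    proof (cases "m l < n")
      case False
      then show ?thesis using below[of l n] y_less[of "l - 1" l] that by auto
    next
      case True
      show ?thesis
      proof (cases "n \<le> m (l + 1)")
        case True
        then show ?thesis using below[of "l + 1" n] above[of l n] \<open>m l < n\<close> that by auto
      next
        case False
        then show ?thesis using above[of "l + 1" n] y_less[of l "l + 1"] that by auto
      qed
    qed
    have no_wall: "f n = f (n + 1)" if n: "n \<in> {m 1..m k}" "n \<notin> m ` {1..k}" for n
    proof -
      define l where "l = Max {l \<in> {1..k}. m l \<le> n}"
      have fin: "finite {l \<in> {1..k}. m l \<le> n}" "{l \<in> {1..k}. m l \<le> n} \<noteq> {}"
        using n k by auto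
      have l: "1 \<le> l" "l \<le> k" "m l \<le> n" using Max_in[OF fin] unfolding l_def by auto
      have "m l \<noteq> n" using n(2) l by auto
      with l have "m l < n" by simp
      then have "l \<noteq> k" using n(1) by auto
      then have "l < k" using l by simp
      have "\<not> m (l + 1) \<le> n"
      proof
        assume "m (l + 1) \<le> n"
        then have "l + 1 \<le> l"
          unfolding l_def using Max_ge[OF fin(1), of "l + 1"] \<open>l < k\<close> l_def by auto
        then show False by simp
      qed
      then show ?thesis using mid[of l n] mid[of l "n + 1"] l \<open>l < k\<close> \<open>m l < n\<close> by auto
    qed
    have walls: "f (m l) \<noteq> f (m l + 1)" if "l \<in> {1..k}" for l
      using left[of l] right[of l] y_less[of "l - 1" l] that by auto
    have surv: "\<exists>n. f n = y l" if "l \<in> {0..k}" for l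
    proof (cases "l = 0")
      case True
      then show ?thesis using left[of 1] k by auto
    next
      case False
      then show ?thesis using right[of l] that by auto
    qed
    have first: "n \<le> m 1" if "f n = y 0" for n
      using above[of 1 n] y_less[of 0 1] k that by force
    have last: "m k < n" if "f n = y k" for n
      using below[of k n] y_less[of "k - 1" k] k that by force
    show "contains_pattern f k x y"
      unfolding contains_pattern_iff_countable[OF x k]
      using walls no_wall surv first last mid left[of 1] right[of k] k by auto
  qed
qed

section \<open>The probability of a pattern\<close>

lemma (in skip_free) det_pattern_matrix:
  "Determinant.det (pattern_matrix (trans_prob Pr 0 T) k x y) =
   row_det (2 * k) (\<lambda>i j. measure (Pr 0 (start_site x (Suc i)))
       {v \<in> space (Pr 0 (start_site x (Suc i))). v T \<in> column_set y j} - column_shift i j)"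
proof -
  have cdf: "cdf_at (trans_prob Pr 0 T) a z = measure (Pr 0 a) {v \<in> space (Pr 0 a). v T \<in> {..z}}" for a z
  proof -
    interpret prob_space "Pr 0 a" by (rule prob_space_Pr_0)
    have "((\<lambda>z. measure (Pr 0 a) {v \<in> space (Pr 0 a). v T = z}) has_sum
        measure (Pr 0 a) {v \<in> space (Pr 0 a). v T \<in> {..z}}) {..z}"
      using T_pos by (intro has_sum_measure_values finite_measure_axioms measurable_eval) auto
    then show ?thesis unfolding cdf_at_def trans_prob_def by (rule infsumI)
  qed
  have "pattern_entry (trans_prob Pr 0 T) k x y (i + 1) (j + 1) =
      measure (Pr 0 (start_site x (Suc i)))
       {v \<in> space (Pr 0 (start_site x (Suc i))). v T \<in> column_set y j} - column_shift i j"
    if "i < 2 * k" "j < 2 * k" for i j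
  proof -
    consider "j = 0" | "j \<noteq> 0" "even j" | "odd j" by blast
    then show ?thesis
    proof cases
      case 2
      then have "Suc j \<noteq> 2 * k" by presburger
      with 2 show ?thesis
        by (simp add: pattern_entry_def column_set_def column_shift_def cdf)
    next
      case 3
      then have "j \<noteq> 0" by (intro notI) simp
      with 3 show ?thesis
        by (cases "Suc j = 2 * k")
           (simp_all add: pattern_entry_def column_set_def column_shift_def trans_prob_def)
    qed (simp add: pattern_entry_def column_set_def column_shift_def trans_prob_def)
  qed
  then show ?thesis
    unfolding pattern_matrix_def row_det_def
    by (intro arg_cong[where f = Determinant.det] eq_matI) auto
qed

text \<open>
  Monotonicity involves countably many pairs of sites, and the joint law of each pair is that of
  a coalescing system of two particles.
\<close>

lemma coalescing_system_AE_mono: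
  assumes "skip_free T Pr" "coalescing_system T Pr M Z"
  shows "AE \<omega> in M. mono (\<lambda>n. Z T n \<omega>)"
proof -
  interpret skip_free T Pr by fact
  have "AE \<omega> in M. Z T a \<omega> \<le> Z T b \<omega>" if "a < b" for a b
  proof -
    note [measurable] = coalescing_system_distr(1)[OF assms, of "{a, b}"]
      coalescing_system_distr(2)[OF assms, of "{a, b}"]
    let ?N = "Pi\<^sub>M ({0..T} \<times> {a, b}) (\<lambda>_. count_space UNIV) :: (real \<times> int \<Rightarrow> int) measure"
    have T: "(T, a) \<in> {0..T} \<times> {a, b}" "(T, b) \<in> {0..T} \<times> {a, b}" using T_pos by auto
    have "Measurable.pred ?N (\<lambda>q. q (T, a) \<le> q (T, b))"
      using T by measurable
    then have P: "{q \<in> space ?N. q (T, a) \<le> q (T, b)} \<in> sets ?N" by simp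
    have "AE q in distr (Pi\<^sub>M {a, b} (Pr 0)) ?N (\<lambda>w. \<lambda>(t, x)\<in>{0..T} \<times> {a, b}. coalesce {a, b} w x t).
        q (T, a) \<le> q (T, b)"
      using AE_coalesce_pair_ordered[OF that, unfolded driving_law_def] T
      by (subst AE_distr_iff[OF _ P]) simp_all
    then have "AE q in distr M ?N (\<lambda>\<omega>. \<lambda>(t, x)\<in>{0..T} \<times> {a, b}. Z t x \<omega>). q (T, a) \<le> q (T, b)"
      by (subst coalescing_system_distr(3)[OF assms]) simp_all
    then show ?thesis
      using T by (subst (asm) AE_distr_iff[OF _ P]) auto
  qed
  then have "AE \<omega> in M. \<forall>a b. a < b \<longrightarrow> Z T a \<omega> \<le> Z T b \<omega>"
    by (simp add: AE_all_countable AE_impI)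
  then show ?thesis
    by eventually_elim (auto simp: mono_def le_less)
qed

theorem theorem1p1:
  fixes T :: real
    and Pr :: "real \<Rightarrow> int \<Rightarrow> (real \<Rightarrow> int) measure"
    and M :: "'a measure"
    and Z :: "real \<Rightarrow> int \<Rightarrow> 'a \<Rightarrow> int"
    and k :: nat
    and x :: "nat \<Rightarrow> real"
    and y :: "nat \<Rightarrow> int"
  assumes "T > 0"
    and "skip_free_process T Pr"
    and "coalescing_system T Pr M Z"
    and "k \<ge> 1"
    and "\<And>l. l \<in> {1..k} \<Longrightarrow> x l \<in> half_integers"
    and "strict_mono_on {1..k} x"
    and "strict_mono_on {0..k} y"
  shows "measure M {\<omega> \<in> space M. contains_pattern (\<lambda>n. Z T n \<omega>) k x y} =
         Determinant.det (pattern_matrix (trans_prob Pr 0 T) k x y)"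
proof -
  have sf: "skip_free T Pr" using assms(1,2) by (rule skip_free.intro)
  interpret skip_free T Pr by (rule sf)
  interpret M: prob_space M using assms(3) by (simp add: coalescing_system_def)
  have Z [measurable]: "Z T n \<in> measurable M (count_space UNIV)" for n
    using assms(1,3) by (auto simp: coalescing_system_def)
  have "\<forall>l\<in>{1..k}. \<exists>n. x l = of_int n + 1/2"
    using assms(5) by (auto simp: half_integers_def)
  then obtain m where m: "\<forall>l\<in>{1..k}. x l = of_int (m l) + 1/2" by metis
  define s where "s i = start_site x (Suc i)" for i
  define A where "A = s ` {..<2 * k}"
  have A: "finite A" "\<And>i. i < 2 * k \<Longrightarrow> s i \<in> A" by (auto simp: A_def)
  let ?E = "\<lambda>\<omega>. contains_pattern (\<lambda>n. Z T n \<omega>) k x y"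
  let ?D = "\<lambda>z. row_det (2 * k) (\<lambda>i j. of_bool (z i \<in> column_set y j) - column_shift i j)"
  have s_mono: "s i \<le> s j" if "i \<le> j" "j < 2 * k" for i j
    unfolding s_def using that by (rule start_site_mono[OF m assms(6)])
  have E [measurable]: "Measurable.pred M ?E"
    unfolding contains_pattern_iff_countable[OF m assms(4)] by measurable
  have "measure M {\<omega> \<in> space M. ?E \<omega>} = (\<integral>\<omega>. of_bool (?E \<omega>) \<partial>M)"
  proof -
    have "(\<integral>\<omega>. of_bool (?E \<omega>) \<partial>M) = (\<integral>\<omega>. indicator {\<omega> \<in> space M. ?E \<omega>} \<omega> \<partial>M :: real)"
      by (intro Bochner_Integration.integral_cong) (auto simp: indicator_def)
    then show ?thesis by (simp add: Int_absorb2 subset_eq)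
  qed
  also have "\<dots> = (\<integral>\<omega>. ?D (\<lambda>i. Z T (s i) \<omega>) \<partial>M)"
  proof (rule integral_cong_AE)
    show "(\<lambda>\<omega>. ?D (\<lambda>i. Z T (s i) \<omega>)) \<in> borel_measurable M"
      by (rule measurable_row_det_of_bool) (rule Z)
    show "AE \<omega> in M. of_bool (?E \<omega>) = ?D (\<lambda>i. Z T (s i) \<omega>)"
      using coalescing_system_AE_mono[OF sf assms(3)]
    proof eventually_elim
      case (elim \<omega>)
      have "?D (\<lambda>i. Z T (s i) \<omega>) = of_bool (\<forall>i<2 * k. Z T (s i) \<omega> = y (Suc i div 2))"
        using s_mono by (intro row_det_pattern assms monoD[OF elim])
      then show ?case
        using contains_pattern_iff_endpoints[OF m assms(4,6,7) elim] by (simp add: s_def)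
    qed
  qed measurable
  also have "\<dots> = (\<integral>\<omega>. ?D (\<lambda>i. (\<lambda>(t, x)\<in>{0..T} \<times> A. Z t x \<omega>) (T, s i)) \<partial>M)"
    using A(2) assms(1) by (intro Bochner_Integration.integral_cong row_det_cong) auto
  also have "\<dots> = (\<integral>w. ?D (\<lambda>i. (\<lambda>(t, x)\<in>{0..T} \<times> A. coalesce A w x t) (T, s i)) \<partial>Pi\<^sub>M A (Pr 0))"
    using A assms(1)
    by (intro coalescing_system_transfer[OF sf assms(3) A(1), where f = "\<lambda>q. ?D (\<lambda>i. q (T, s i))"]
        measurable_row_det_of_bool measurable_component_singleton) auto
  also have "\<dots> = (\<integral>w. ?D (\<lambda>i. coalesce A w (s i) T) \<partial>driving_law A)"
    unfolding driving_law_def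
    using A(2) assms(1) by (intro Bochner_Integration.integral_cong row_det_cong) auto
  also have "\<dots> = row_det (2 * k)
      (\<lambda>i j. measure (Pr 0 (s i)) {v \<in> space (Pr 0 (s i)). v T \<in> column_set y j} - column_shift i j)"
    by (rule integral_row_det_coalesce[OF A])
  also have "\<dots> = Determinant.det (pattern_matrix (trans_prob Pr 0 T) k x y)"
    unfolding det_pattern_matrix s_def ..
  finally show ?thesis .
qed

end
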